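(* Let $n\ge 1$, let $\alpha\in(-\infty,0]$, and let $f\in C_\alpha(\mathbb{R}^n)$ be an integrable function with full-dimensional support. Then $$\|f\star_\alpha\bar f\|_1\le\binom{2n}{n}\|f\|_1 .$$ For $n\ge 2$, equality holds if and only if $f$ is the characteristic function of a simplex. For $n=1$, equality holds if and only if $f$ is monotone on its support.
   Context: For $\alpha\in[-\infty,0]$, a function $f:\mathbb{R}^n\to[0,\infty)$ is $\alpha$-concave if for all $x,y$ with $f(x),f(y)>0$ and all $\lambda\in[0,1]$, $f(\lambda x+(1-\lambda)y)\ge[\lambda f(x)^\alpha+(1-\lambda)f(y)^\alpha]^{1/\alpha}$, where the right side is read as $f(x)^\lambda f(y)^{1-\lambda}$ for $\alpha=0$ and as $\min\{f(x),f(y)\}$ for $\alpha=-\infty$. $C_\alpha(\mathbb{R}^n)$ is the set of upper semicontinuous $\alpha$-concave $f:\mathbb{R}^n\to[0,\infty)$ with $\|f\|_\infty=f(0)=1$ and $\lim_{|x|\to\infty}f(x)=0$. The $\alpha$-sum is $(f\star_\alpha g)(x)=\sup_{y+z=x}(f(y)^\alpha+g(z)^\alpha-1)^{1/\alpha}$ for $-\infty<\alpha<0$ (the expression is $0$ whenever $f(y)=0$ or $g(z)=0$), and $(f\star_0 g)(x)=\sup_{y+z=x}f(y)g(z)$. $\bar f(x)=f(-x)$. $\|f\|_1=\int_{\mathbb{R}^n}f(x)\,dx$ for $f\ge 0$. The support of $f$ is the convex set $\{f>0\}$; full-dimensional means it has nonempty interior. "Monotone on its support" means non-increasing on the support or non-decreasing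 on the support. *)

theory Defs
  imports "HOL-Analysis.Analysis"
begin

text \<open>
  The order \<^term>\<open>\<alpha>\<close> is a finite real number with \<^prop>\<open>\<alpha> \<le> 0\<close>;
  the limiting order minus infinity is not represented.
  Functions into the nonnegative reals are real-valued functions, with nonnegativity imposed
  as part of the class \<open>C_alpha\<close>.
\<close>

definition alpha_mean :: "real \<Rightarrow> real \<Rightarrow> real \<Rightarrow> real \<Rightarrow> real" where
  "alpha_mean \<alpha> t a b =
     (if \<alpha> = 0 then a powr t * b powr (1 - t)
      else (t * a powr \<alpha> + (1 - t) * b powr \<alpha>) powr (1 / \<alpha>))"

definition alpha_concave :: "real \<Rightarrow> (real ^ 'n \<Rightarrow> real) \<Rightarrow> bool" where
  "alpha_concave \<alpha> f \<longleftrightarrow>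
     (\<forall>x y. \<forall>t\<in>{0..1}. f x > 0 \<longrightarrow> f y > 0 \<longrightarrow>
        f (t *\<^sub>R x + (1 - t) *\<^sub>R y) \<ge> alpha_mean \<alpha> t (f x) (f y))"

definition upper_semicontinuous :: "('a::topological_space \<Rightarrow> real) \<Rightarrow> bool" where
  "upper_semicontinuous f \<longleftrightarrow> (\<forall>x. \<forall>c > f x. \<forall>\<^sub>F y in nhds x. f y < c)"

definition sup_norm :: "(real ^ 'n \<Rightarrow> real) \<Rightarrow> ereal" where
  "sup_norm f = (SUP x. ereal \<bar>f x\<bar>)"

definition C_alpha :: "real \<Rightarrow> (real ^ 'n \<Rightarrow> real) set" where
  "C_alpha \<alpha> = {f. (\<forall>x. 0 \<le> f x) \<and> upper_semicontinuous f \<and> alpha_concave \<alpha> f \<and>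
                   sup_norm f = 1 \<and> f 0 = 1 \<and> (f \<longlongrightarrow> 0) at_infinity}"

definition alpha_term :: "real \<Rightarrow> real \<Rightarrow> real \<Rightarrow> real" where
  "alpha_term \<alpha> a b =
     (if \<alpha> = 0 then a * b
      else if a = 0 \<or> b = 0 then 0
      else (a powr \<alpha> + b powr \<alpha> - 1) powr (1 / \<alpha>))"

text \<open>
  For functions in \<^term>\<open>C_alpha \<alpha>\<close> all terms of the supremum lie in the unit interval,
  so the real supremum below is the actual one.
\<close>
definition alpha_sum ::
    "real \<Rightarrow> (real ^ 'n \<Rightarrow> real) \<Rightarrow> (real ^ 'n \<Rightarrow> real) \<Rightarrow> real ^ 'n \<Rightarrow> real" where
  "alpha_sum \<alpha> f g x = Sup {alpha_term \<alpha> (f y) (g z) | y z. y + z = x}"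

definition reflect :: "(real ^ 'n \<Rightarrow> real) \<Rightarrow> real ^ 'n \<Rightarrow> real" where
  "reflect f x = f (- x)"

definition support :: "(real ^ 'n \<Rightarrow> real) \<Rightarrow> (real ^ 'n) set" where
  "support f = {x. f x > 0}"

text \<open>
  The integral of a nonnegative function, valued in the extended nonnegative reals so that an
  upper bound includes integrability. All functions it is applied to are upper
  semicontinuous, hence Borel measurable.
\<close>
definition L1_norm :: "(real ^ 'n \<Rightarrow> real) \<Rightarrow> ennreal" where
  "L1_norm f = (\<integral>\<^sup>+ x. ennreal (f x) \<partial>lborel)"

text \<open>
  The order on \<^typ>\<open>real ^ 'n\<close> is componentwise, so for a one-element index type
  this is monotonicity on the real line.
\<close>
definition monotone_on_support :: "(real ^ 'n \<Rightarrow> real) \<Rightarrow> bool" where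
  "monotone_on_support f \<longleftrightarrow> mono_on (support f) f \<or> antimono_on (support f) f"

end

theory Submission
  imports Defs
begin

text \<open>
  Superlevel sets reduce the functional inequality to the classical Rogers--Shephard inequality
  for convex bodies. Write \<open>L\<^sub>s = {f \<ge> s}\<close>, a compact convex set, and let \<open>W\<^sub>s\<close> be the set of
  differences \<open>y - z\<close> for which the pair \<open>(f y, f z)\<close> has \<open>\<alpha>\<close>-term at least \<open>s\<close>. The levels of the
  \<open>\<alpha>\<close>-sum of \<open>f\<close> with its reflection are, up to strictness, the sets \<open>W\<^sub>s\<close>. Since the \<open>\<alpha>\<close>-term of
  two numbers in the unit interval is at most either of them, \<open>W\<^sub>s\<close> lies in the difference body
  \<open>L\<^sub>s - L\<^sub>s\<close>, whose volume is at most \<open>2n choose n\<close> times that of \<open>L\<^sub>s\<close>. Integration over \<open>s\<close>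
  gives the inequality (\<open>L1_norm_alpha_sum_reflect_le\<close>).

  The Rogers--Shephard inequality (\<open>rogers_shephard\<close>) comes from the identity
  \<open>\<integral> vol (K \<inter> (K + x)) dx = vol K ^ 2\<close>: if \<open>x = (1 - u) (a - b)\<close> with \<open>a, b \<in> K\<close>, then
  \<open>K \<inter> (K + x)\<close> contains the homothet \<open>u K + (1 - u) a\<close>, and integrating the volume \<open>u ^ n vol K\<close>
  for the largest such \<open>u\<close> over \<open>x\<close> produces a Beta integral. Equality forces \<open>K \<inter> (K + x)\<close> to
  coincide with such a homothet for almost every \<open>x\<close> with overlapping interiors, and a compactness
  argument extends the inclusion needed below to every such \<open>x\<close>. In terms of the cone over \<open>K\<close>
  this says that two distinct extreme rays have a least upper bound, namely their sum. Peeling one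
  extreme point after another off a convex combination then shows that a point of the convex
  hull of some extreme points has no component along any further extreme point
  (\<open>convex_hull_of_extreme_points_no_component\<close>); by Radon's theorem the extreme points are affinely
  independent, so \<open>K\<close> is a simplex (\<open>simplex_of_rogers_shephard_equality\<close>). Conversely, two
  translates of a simplex meet in a homothet, as minima of barycentric coordinates show.

  If equality holds for \<open>f\<close>, then for almost every \<open>s\<close> for which \<open>L\<^sub>s\<close> has interior, \<open>L\<^sub>s\<close> is a
  simplex and \<open>W\<^sub>s = L\<^sub>s - L\<^sub>s\<close>. A difference \<open>v - w\<close> of two vertices is a difference of points of
  the simplex in one way only, so the values of \<open>f\<close> at \<open>v\<close> and \<open>w\<close> have \<open>\<alpha>\<close>-term at least \<open>s\<close>;
  hence a vertex \<open>v\<close> at which \<open>f\<close> is minimal and below 1 forces the value 1 at all other vertices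
  (\<open>equality_vertex_values\<close>). For \<open>n \<ge> 2\<close> the levels slightly above \<open>f v\<close> contain parts of two edges
  at \<open>v\<close>, but not \<open>v\<close>, and so cannot be simplices; thus \<open>f\<close> is 1 on its support. For \<open>n = 1\<close> each
  level is an interval with value 1 at one of its ends, which is monotonicity.
\<close>

section \<open>Convex bodies and Lebesgue measure\<close>

definition difference_body :: "'a::euclidean_space set \<Rightarrow> 'a set" where
  "difference_body K = {a - b |a b. a \<in> K \<and> b \<in> K}"

lemma compact_difference_body: "compact K \<Longrightarrow> compact (difference_body K)"
  unfolding difference_body_def by (rule compact_differences)

lemma convex_difference_body: "convex K \<Longrightarrow> convex (difference_body K)"
proof -
  assume "convex K"
  then have "convex (\<Union>x\<in>K. \<Union>y\<in>K. {x - y})" using convex_differences by blast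
  also have "(\<Union>x\<in>K. \<Union>y\<in>K. {x - y}) = difference_body K"
    by (auto simp: difference_body_def)
  finally show ?thesis .
qed

lemma interior_difference_body_nonempty:
  fixes K :: "'a::euclidean_space set"
  assumes "interior K \<noteq> {}"
  shows "interior (difference_body K) \<noteq> {}"
proof -
  obtain c where c: "c \<in> interior K" using assms by blast
  have "(\<lambda>x. x - c) ` interior K \<subseteq> difference_body K"
    using c interior_subset by (fastforce simp: difference_body_def)
  moreover have "open ((\<lambda>x. x - c) ` interior K)"
    by (rule open_translation_subtract) simp
  ultimately show ?thesis
    using c interior_maximal by (metis empty_iff image_eqI subsetD)
qed

text \<open>
  The interior of \<open>A\<close> minus \<open>B\<close> is open and null, hence empty, and \<open>A\<close> is the closure of its
  interior. Equality of volumes becomes equality of sets through this lemma, both for homothets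
  inside overlaps and for the sets of differences inside difference bodies.
\<close>
lemma convex_eq_closed_subset_same_measure:
  fixes A B :: "'a::euclidean_space set"
  assumes "convex A" "closed A" "interior A \<noteq> {}" "closed B" "B \<subseteq> A"
    and le: "emeasure lborel A \<le> emeasure lborel B" and fin: "emeasure lborel A < \<infinity>"
  shows "A = B"
proof -
  have [measurable]: "A \<in> sets borel" "B \<in> sets borel" using assms by auto
  have "emeasure lborel (A - B) = emeasure lborel A - emeasure lborel B"
    using assms emeasure_mono[of B A lborel] by (intro emeasure_Diff) (auto simp: top_unique)
  also have "\<dots> = 0" using le fin by (simp add: diff_eq_0_iff_ennreal)
  finally have z: "emeasure lborel (A - B) = 0" .
  have op: "open (interior A - B)" using assms by auto
  have "emeasure lborel (interior A - B) \<le> emeasure lborel (A - B)"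
    using interior_subset[of A] by (intro emeasure_mono) auto
  then have "negligible (interior A - B)"
    using z op by (simp add: negligible_iff_emeasure0 borel_open)
  then have "interior A \<subseteq> B" using open_not_negligible[OF op] by blast
  then have "closure (interior A) \<subseteq> B" using \<open>closed B\<close> closure_minimal by blast
  then show ?thesis using assms convex_closure_interior[of A] by auto
qed

lemma emeasure_homothet:
  fixes K :: "'a::euclidean_space set"
  assumes "compact K" "0 \<le> u"
  shows "emeasure lborel ((\<lambda>y. u *\<^sub>R y + c) ` K) = ennreal (u ^ DIM('a)) * emeasure lborel K"
proof -
  have "compact ((\<lambda>y. u *\<^sub>R y + c) ` K)"
    using assms by (intro compact_continuous_image continuous_intros)
  then have "emeasure lborel ((\<lambda>y. u *\<^sub>R y + c) ` K) = emeasure lebesgue ((\<lambda>y. u *\<^sub>R y + c) ` K)"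
    by (simp add: borel_compact)
  also have "\<dots> = ennreal (u ^ DIM('a)) * emeasure lborel K"
    using assms by (subst emeasure_lebesgue_affine) (auto simp: borel_compact)
  finally show ?thesis .
qed

text \<open>
  A convex set without interior lies in a hyperplane, and its differences in the parallel
  hyperplane through the origin.
\<close>
lemma emeasure_difference_body_empty_interior:
  fixes K :: "'a::euclidean_space set"
  assumes "convex K" "compact K" "interior K = {}"
  shows "emeasure lborel (difference_body K) = 0"
proof -
  obtain a b where ab: "a \<noteq> 0" "K \<subseteq> {x. a \<bullet> x = b}"
    using empty_interior_subset_hyperplane[OF assms(1,3)] by blast
  have "difference_body K \<subseteq> {x. a \<bullet> x = 0}"
    using ab(2) by (auto simp: difference_body_def inner_diff_right subset_iff)
  then have "negligible (difference_body K)"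
    using negligible_hyperplane[of a 0] ab(1) negligible_subset by blast
  then show ?thesis
    using compact_difference_body[OF assms(2)]
    by (simp add: negligible_iff_emeasure0 borel_compact)
qed

text \<open>
  This is \<open>n B(n, n + 1) = (n!)\<^sup>2 / (2n)!\<close>, the source of the binomial coefficient.
\<close>
lemma nn_integral_beta_binomial:
  assumes "n \<ge> 1"
  shows "(\<integral>\<^sup>+u. ennreal (real n * u ^ (n - 1) * (1 - u) ^ n) * indicator {0..1} u \<partial>lborel)
           = ennreal (1 / real ((2 * n) choose n))"
proof -
  have "((\<lambda>t. t powr (real n - 1) * (1 - t) powr (real (Suc n) - 1)) has_integral
     Beta (real n) (real (Suc n))) {0<..<1}"
    using has_integral_Beta_real[of "real n" "real (Suc n)"] assms
    by (simp add: has_integral_Icc_iff_Ioo)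
  then have "((\<lambda>t. t ^ (n-1) * (1 - t) ^ n) has_integral Beta (real n) (real (Suc n))) {0<..<1::real}"
  proof (rule has_integral_eq[rotated])
    fix t :: real assume "t \<in> {0<..<1}"
    then show "t powr (real n - 1) * (1 - t) powr (real (Suc n) - 1) = t ^ (n - 1) * (1 - t) ^ n"
      using assms by (simp flip: powr_realpow add: of_nat_diff)
  qed
  then have "((\<lambda>t. real n * (t ^ (n-1) * (1 - t) ^ n)) has_integral
      real n * Beta (real n) (real (Suc n))) {0..1::real}"
    by (intro has_integral_mult_right) (simp add: has_integral_Icc_iff_Ioo)
  also have "real n * Beta (real n) (real (Suc n)) = 1 / real ((2 * n) choose n)"
  proof -
    have "Gamma (real n) * real n = fact n"
      using assms Gamma_fact[of "n - 1", where ?'a = real] fact_reduce[of n, where ?'a = real] by (simp add: of_nat_diff)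
    moreover have "Gamma (real (Suc n)) = fact n"
      using Gamma_fact[of n, where ?'a = real] by (simp add: add.commute)
    moreover have "Gamma (real n + real (Suc n)) = fact (2 * n)"
    proof -
      have "real n + real (Suc n) = 1 + real (2 * n)" by simp
      then show ?thesis using Gamma_fact[of "2 * n", where ?'a = real] by metis
    qed
    ultimately show ?thesis
      using binomial_fact[of n "2 * n", where ?'a = real]
      by (simp add: Beta_def field_simps)
  qed
  finally have "((\<lambda>t. real n * (t ^ (n-1) * (1 - t) ^ n)) has_integral (1 / real ((2 * n) choose n))) {0..1::real}" .
  moreover have "(\<lambda>t. real n * (t ^ (n-1) * (1 - t) ^ n) * indicator {0..1} t)
      = (\<lambda>t. if t \<in> {0..1} then real n * (t ^ (n-1) * (1 - t) ^ n) else 0)"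
    by (auto simp: fun_eq_iff indicator_def)
  ultimately have "((\<lambda>t. real n * (t ^ (n-1) * (1 - t) ^ n) * indicator {0..1} t)
      has_integral (1 / real ((2 * n) choose n))) (UNIV::real set)"
    by (simp only: has_integral_restrict_UNIV)
  then have "(\<integral>\<^sup>+t. ennreal (real n * (t ^ (n-1) * (1 - t) ^ n) * indicator {0..1} t) \<partial>lborel)
     = ennreal (1 / real ((2 * n) choose n))"
    by (intro nn_integral_has_integral_lborel) (auto simp: indicator_def)
  moreover have "ennreal (real n * (t ^ (n-1) * (1 - t) ^ n) * indicator {0..1} t)
      = ennreal (real n * t ^ (n-1) * (1 - t) ^ n) * indicator {0..1} t" for t :: real
    by (auto simp: indicator_def mult.assoc)
  ultimately show ?thesis by simp
qed

lemma AE_eq_of_nn_integral_eq: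
  assumes [measurable]: "u \<in> borel_measurable M" "v \<in> borel_measurable M"
    and le: "\<And>x. u x \<le> v x" and eq: "(\<integral>\<^sup>+x. u x \<partial>M) = (\<integral>\<^sup>+x. v x \<partial>M)"
    and fin: "(\<integral>\<^sup>+x. v x \<partial>M) \<noteq> \<infinity>"
  shows "AE x in M. u x = v x"
proof -
  have "(\<integral>\<^sup>+x. v x - u x \<partial>M) = (\<integral>\<^sup>+x. v x \<partial>M) - (\<integral>\<^sup>+x. u x \<partial>M)"
    using fin eq le by (intro nn_integral_diff) auto
  also have "\<dots> = 0" using eq fin by simp
  finally have "AE x in M. v x - u x = 0" by (subst (asm) nn_integral_0_iff_AE) auto
  moreover have "AE x in M. v x \<noteq> \<infinity>" by (rule nn_integral_PInf_AE[OF _ fin]) simp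
  ultimately show ?thesis
  proof eventually_elim
    case (elim x)
    then show ?case using le[of x] by (simp add: diff_eq_0_iff_ennreal)
  qed
qed

lemma AE_lborel_meets_open:
  fixes U :: "'a::euclidean_space set"
  assumes "AE x in lborel. P x" "open U" "U \<noteq> {}"
  obtains x where "x \<in> U" "P x"
proof -
  from assms(1) obtain N where N: "{x \<in> space lborel. \<not> P x} \<subseteq> N" "emeasure lborel N = 0" "N \<in> sets lborel"
    by (auto elim: AE_E)
  have "negligible N" using N by (simp add: negligible_iff_emeasure0)
  then have "\<not> U \<subseteq> N"
    using assms open_not_negligible negligible_subset by blast
  then show ?thesis using N(1) that by auto
qed

section \<open>The Rogers--Shephard inequality\<close>

text \<open>
  The set in question is \<open>K \<inter> (K + x)\<close>.
\<close>
definition covariogram :: "'a::euclidean_space set \<Rightarrow> 'a \<Rightarrow> ennreal" where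
  "covariogram K x = emeasure lborel {y \<in> K. y - x \<in> K}"

lemma closed_overlap:
  fixes K :: "'a::euclidean_space set"
  assumes "closed K" shows "closed {y \<in> K. y - x \<in> K}"
proof -
  have "closed (K \<inter> (\<lambda>y. y - x) -` K)"
    using assms by (intro closed_Int closed_vimage) (auto intro: continuous_intros)
  then show ?thesis by (simp add: Int_def vimage_def)
qed

text \<open>
  Integrate over \<open>x\<close> first: for fixed \<open>y\<close> the condition \<open>y - x \<in> K\<close> describes a reflected translate
  of \<open>K\<close>.
\<close>
lemma nn_integral_covariogram:
  fixes K :: "'a::euclidean_space set"
  assumes "compact K"
  shows "covariogram K \<in> borel_measurable lborel"
    and "(\<integral>\<^sup>+x. covariogram K x \<partial>lborel) = emeasure lborel K * emeasure lborel K"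
proof -
  define Q :: "('a \<times> 'a) set" where "Q = {(x, y). y \<in> K \<and> y - x \<in> K}"
  have "closed (snd -` K \<inter> (\<lambda>p. snd p - fst p) -` K :: ('a \<times> 'a) set)"
    using compact_imp_closed[OF assms]
    by (intro closed_Int closed_vimage) (auto intro!: continuous_intros)
  also have "(snd -` K \<inter> (\<lambda>p. snd p - fst p) -` K :: ('a \<times> 'a) set) = Q"
    by (auto simp: Q_def)
  finally have "Q \<in> sets borel" by simp
  then have Q[measurable]: "Q \<in> sets (lborel \<Otimes>\<^sub>M lborel)"
    by (simp add: borel_prod[symmetric] cong: sets_pair_measure_cong)
  have cov: "covariogram K x = (\<integral>\<^sup>+y. indicator Q (x, y) \<partial>lborel)" for x
  proof -
    have "(\<integral>\<^sup>+y. indicator Q (x, y) \<partial>lborel) = (\<integral>\<^sup>+y. indicator {y \<in> K. y - x \<in> K} y \<partial>lborel)"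
      by (intro nn_integral_cong) (auto simp: Q_def indicator_def)
    then show ?thesis
      using closed_overlap[OF compact_imp_closed[OF assms], of x] by (simp add: covariogram_def)
  qed
  show "covariogram K \<in> borel_measurable lborel"
    unfolding cov by measurable
  have "(\<integral>\<^sup>+x. covariogram K x \<partial>lborel)
      = (\<integral>\<^sup>+y. (\<integral>\<^sup>+x. indicator Q (x, y) \<partial>lborel) \<partial>lborel)"
    unfolding cov by (rule lborel_pair.Fubini'[symmetric]) simp
  also have "\<dots> = (\<integral>\<^sup>+y. emeasure lborel K * indicator K y \<partial>lborel)"
  proof (intro nn_integral_cong)
    fix y :: 'a
    have im: "{x. y - x \<in> K} = (\<lambda>k. (- 1) *\<^sub>R k + y) ` K"
    proof (intro set_eqI iffI)
      fix x assume "x \<in> {x. y - x \<in> K}"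
      then show "x \<in> (\<lambda>k. (- 1) *\<^sub>R k + y) ` K"
        by (intro image_eqI[of _ _ "y - x"]) auto
    qed auto
    have "compact ((\<lambda>k. (- 1) *\<^sub>R k + y) ` K)"
      using assms by (intro compact_continuous_image continuous_intros)
    then have meas: "{x. y - x \<in> K} \<in> sets borel" using im by (simp add: borel_compact)
    then have "emeasure lborel ((\<lambda>k. (- 1) *\<^sub>R k + y) ` K) = emeasure lebesgue ((\<lambda>k. (- 1) *\<^sub>R k + y) ` K)"
      unfolding im by simp
    also have "emeasure lebesgue ((\<lambda>k. (- 1) *\<^sub>R k + y) ` K) = emeasure lborel K"
      using assms by (subst emeasure_lebesgue_affine) (auto simp: borel_compact)
    finally have e: "emeasure lborel {x. y - x \<in> K} = emeasure lborel K" using im by simp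
    have "(\<integral>\<^sup>+x. indicator Q (x, y) \<partial>lborel)
        = (\<integral>\<^sup>+x. indicator K y * indicator {x. y - x \<in> K} x \<partial>lborel)"
      by (intro nn_integral_cong) (auto simp: Q_def indicator_def)
    also have "\<dots> = emeasure lborel K * indicator K y"
      using meas e by (simp add: nn_integral_cmult mult.commute)
    finally show "(\<integral>\<^sup>+x. indicator Q (x, y) \<partial>lborel) = emeasure lborel K * indicator K y" .
  qed
  also have "\<dots> = emeasure lborel K * emeasure lborel K"
    using assms by (simp add: nn_integral_cmult_indicator borel_compact)
  finally show "(\<integral>\<^sup>+x. covariogram K x \<partial>lborel) = emeasure lborel K * emeasure lborel K" .
qed

text \<open>
  The fibre over \<open>u\<close> is the difference body shrunk by the factor \<open>1 - u\<close>. For convex compact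
  \<open>K\<close> the fibre over a point \<open>x\<close> of the difference body is the interval from 0 to \<open>1 - \<parallel>x\<parallel>\<close>, where \<open>\<parallel>x\<parallel>\<close> is the gauge of the difference body.
\<close>
definition shrink_graph :: "'a::euclidean_space set \<Rightarrow> ('a \<times> real) set" where
  "shrink_graph K = {((1 - u) *\<^sub>R (a - b), u) |a b u. a \<in> K \<and> b \<in> K \<and> 0 \<le> u \<and> u \<le> 1}"

text \<open>
  For convex compact \<open>K\<close> this integral equals \<open>(1 - \<parallel>x\<parallel>) ^ n\<close>, with the gauge \<open>\<parallel>x\<parallel>\<close> of the difference body and the value 0
  outside it. Writing it as an integral of a derivative over the fibres of
  \<open>shrink_graph\<close> makes its total integral a direct application of Fubini's theorem.
\<close>
definition overlap_profile :: "'a::euclidean_space set \<Rightarrow> 'a \<Rightarrow> ennreal" where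
  "overlap_profile K x =
     (\<integral>\<^sup>+u. ennreal (real DIM('a) * u ^ (DIM('a) - 1)) * indicator (shrink_graph K) (x, u) \<partial>lborel)"

lemma compact_shrink_graph:
  assumes "compact K" shows "compact (shrink_graph K)"
proof -
  have "shrink_graph K = (\<lambda>(a, b, u). ((1 - u) *\<^sub>R (a - b), u)) ` (K \<times> K \<times> {0..1})"
  proof (intro set_eqI iffI)
    fix p assume "p \<in> shrink_graph K"
    then obtain a b u where "a \<in> K" "b \<in> K" "0 \<le> u" "u \<le> 1" "p = ((1 - u) *\<^sub>R (a - b), u)"
      by (auto simp: shrink_graph_def)
    then show "p \<in> (\<lambda>(a, b, u). ((1 - u) *\<^sub>R (a - b), u)) ` (K \<times> K \<times> {0..1})"
      by (intro image_eqI[of _ _ "(a, b, u)"]) auto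
  next
    fix p assume "p \<in> (\<lambda>(a, b, u). ((1 - u) *\<^sub>R (a - b), u)) ` (K \<times> K \<times> {0..1})"
    then show "p \<in> shrink_graph K"
      unfolding shrink_graph_def by clarsimp blast
  qed
  also have "compact \<dots>"
    using assms
    by (intro compact_continuous_image compact_Times) (auto intro!: continuous_intros simp: case_prod_unfold)
  finally show ?thesis .
qed

lemma nn_integral_overlap_profile:
  fixes K :: "'a::euclidean_space set"
  assumes "compact K"
  shows "overlap_profile K \<in> borel_measurable lborel"
    and "(\<integral>\<^sup>+x. overlap_profile K x \<partial>lborel)
      = ennreal (1 / real ((2 * DIM('a)) choose DIM('a))) * emeasure lborel (difference_body K)"
proof -
  let ?n = "DIM('a)"
  have "shrink_graph K \<in> sets borel"
    using compact_shrink_graph[OF assms] by (simp add: borel_compact)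
  then have [measurable]: "shrink_graph K \<in> sets (lborel \<Otimes>\<^sub>M lborel)"
    by (simp add: borel_prod[symmetric] cong: sets_pair_measure_cong)
  show "overlap_profile K \<in> borel_measurable lborel"
    unfolding overlap_profile_def by measurable
  have "(\<integral>\<^sup>+x. overlap_profile K x \<partial>lborel)
     = (\<integral>\<^sup>+u. (\<integral>\<^sup>+x. ennreal (real ?n * u ^ (?n - 1)) * indicator (shrink_graph K) (x, u) \<partial>lborel) \<partial>lborel)"
    unfolding overlap_profile_def by (rule lborel_pair.Fubini'[symmetric]) simp
  also have "\<dots> = (\<integral>\<^sup>+u. emeasure lborel (difference_body K)
      * (ennreal (real ?n * u ^ (?n - 1) * (1 - u) ^ ?n) * indicator {0..1} u) \<partial>lborel)"
  proof (intro nn_integral_cong)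
    fix u :: real
    show "(\<integral>\<^sup>+x. ennreal (real ?n * u ^ (?n - 1)) * indicator (shrink_graph K) (x, u) \<partial>lborel)
        = emeasure lborel (difference_body K)
          * (ennreal (real ?n * u ^ (?n - 1) * (1 - u) ^ ?n) * indicator {0..1} u)"
    proof (cases "0 \<le> u \<and> u \<le> 1")
      case True
      let ?H = "(\<lambda>d. (1 - u) *\<^sub>R d + 0) ` difference_body K"
      have cD: "compact (difference_body K)" by (rule compact_difference_body[OF assms])
      then have "compact ?H" by (intro compact_continuous_image continuous_intros)
      then have H: "?H \<in> sets borel" by (rule borel_compact)
      have "(\<integral>\<^sup>+x. ennreal (real ?n * u ^ (?n - 1)) * indicator (shrink_graph K) (x, u) \<partial>lborel)
          = (\<integral>\<^sup>+x. ennreal (real ?n * u ^ (?n - 1)) * indicator ?H x \<partial>lborel)"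
        using True
        by (intro nn_integral_cong)
           (auto simp: shrink_graph_def difference_body_def indicator_def)
      also have "\<dots> = ennreal (real ?n * u ^ (?n - 1)) * emeasure lborel ?H"
        using H by (simp add: nn_integral_cmult)
      also have "emeasure lborel ?H = ennreal ((1 - u) ^ ?n) * emeasure lborel (difference_body K)"
        using True by (intro emeasure_homothet cD) auto
      also have "ennreal (real ?n * u ^ (?n - 1)) * \<dots>
          = emeasure lborel (difference_body K) * (ennreal (real ?n * u ^ (?n - 1) * (1 - u) ^ ?n) * indicator {0..1} u)"
        using True by (simp add: ennreal_mult ac_simps)
      finally show ?thesis .
    next
      case False
      then have "indicator (shrink_graph K) (x, u) = (0 :: ennreal)" for x
        by (auto simp: shrink_graph_def indicator_def)
      then show ?thesis using False by (simp add: indicator_def)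
    qed
  qed
  also have "\<dots> = emeasure lborel (difference_body K) * ennreal (1 / real ((2 * ?n) choose ?n))"
    by (subst nn_integral_cmult) (use nn_integral_beta_binomial[of ?n] in auto)
  finally show "(\<integral>\<^sup>+x. overlap_profile K x \<partial>lborel)
      = ennreal (1 / real ((2 * ?n) choose ?n)) * emeasure lborel (difference_body K)"
    by (simp add: mult.commute)
qed

lemma nn_integral_power_derivative:
  assumes "n \<ge> 1" "0 \<le> U"
  shows "(\<integral>\<^sup>+u. ennreal (real n * u ^ (n - 1)) * indicator {0..U} u \<partial>lborel) = ennreal (U ^ n)"
proof -
  have "(\<integral>\<^sup>+u. ennreal (real n * u ^ (n - 1)) * indicator {0..U} u \<partial>lborel) = ennreal (U ^ n - 0 ^ n)"
    using assms by (intro nn_integral_FTC_Icc) (auto intro!: derivative_eq_intros)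
  then show ?thesis using assms by simp
qed

text \<open>
  Both \<open>u K + (1 - u) a\<close> and its translate \<open>u K + (1 - u) b\<close> lie in \<open>K\<close> by convexity.
\<close>
lemma homothet_subset_overlap:
  fixes K :: "'a::euclidean_space set"
  assumes "convex K" "a \<in> K" "b \<in> K" "0 \<le> u" "u \<le> 1"
  shows "(\<lambda>k. u *\<^sub>R k + (1 - u) *\<^sub>R a) ` K \<subseteq> {y \<in> K. y - (1 - u) *\<^sub>R (a - b) \<in> K}"
proof (clarsimp, intro conjI)
  fix k assume "k \<in> K"
  then show "u *\<^sub>R k + (1 - u) *\<^sub>R a \<in> K"
    using assms by (intro convexD) auto
  have "u *\<^sub>R k + (1 - u) *\<^sub>R b \<in> K"
    using \<open>k \<in> K\<close> assms by (intro convexD) auto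
  then show "u *\<^sub>R k + (1 - u) *\<^sub>R a - (1 - u) *\<^sub>R (a - b) \<in> K"
    by (simp add: algebra_simps)
qed

lemma covariogram_ge_homothet:
  fixes K :: "'a::euclidean_space set"
  assumes "convex K" "compact K" "a \<in> K" "b \<in> K" "0 \<le> u" "u \<le> 1"
  shows "ennreal (u ^ DIM('a)) * emeasure lborel K \<le> covariogram K ((1 - u) *\<^sub>R (a - b))"
proof -
  have "emeasure lborel ((\<lambda>k. u *\<^sub>R k + (1 - u) *\<^sub>R a) ` K) \<le> covariogram K ((1 - u) *\<^sub>R (a - b))"
    unfolding covariogram_def
    using assms closed_overlap[OF compact_imp_closed[OF assms(2)]]
    by (intro emeasure_mono homothet_subset_overlap) auto
  then show ?thesis using assms by (simp add: emeasure_homothet)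
qed

text \<open>
  The largest \<open>U\<close> with \<open>x \<in> (1 - U) (K - K)\<close> is attained by compactness, and it bounds the range of
  integration that defines the profile.
\<close>
lemma overlap_profile_le:
  fixes K :: "'a::euclidean_space set"
  assumes "compact K" "x \<in> difference_body K"
  obtains U a b where "0 \<le> U" "U \<le> 1" "a \<in> K" "b \<in> K" "x = (1 - U) *\<^sub>R (a - b)"
    "overlap_profile K x \<le> ennreal (U ^ DIM('a))"
proof -
  define S where "S = {u. (x, u) \<in> shrink_graph K}"
  have "S = snd ` (shrink_graph K \<inter> {x} \<times> UNIV)"
    by (force simp: S_def)
  also have "compact (snd ` (shrink_graph K \<inter> {x} \<times> UNIV))"
    using compact_shrink_graph[OF assms(1)]
    by (intro compact_continuous_image compact_Int_closed closed_Times) (auto intro: continuous_intros)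
  finally have "compact S" .
  moreover have "0 \<in> S"
    using assms(2) by (force simp: S_def shrink_graph_def difference_body_def)
  ultimately obtain U where U: "U \<in> S" "\<And>u. u \<in> S \<Longrightarrow> u \<le> U"
    using compact_attains_sup[of S] by blast
  from U(1) obtain a b where ab: "0 \<le> U" "U \<le> 1" "a \<in> K" "b \<in> K" "x = (1 - U) *\<^sub>R (a - b)"
    by (auto simp: S_def shrink_graph_def)
  have "overlap_profile K x
      \<le> (\<integral>\<^sup>+u. ennreal (real DIM('a) * u ^ (DIM('a) - 1)) * indicator {0..U} u \<partial>lborel)"
    unfolding overlap_profile_def
    using U(2) by (intro nn_integral_mono mult_left_mono)
      (auto simp: S_def indicator_def shrink_graph_def)
  also have "\<dots> = ennreal (U ^ DIM('a))"
    using ab(1) by (intro nn_integral_power_derivative) (auto simp: Suc_le_eq)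
  finally show ?thesis using that ab by blast
qed

lemma overlap_profile_outside:
  fixes K :: "'a::euclidean_space set"
  assumes "convex K" "x \<notin> difference_body K"
  shows "overlap_profile K x = 0"
proof -
  have "(x, u) \<notin> shrink_graph K" for u
  proof
    assume "(x, u) \<in> shrink_graph K"
    then obtain a b where *: "a \<in> K" "b \<in> K" "0 \<le> u" "u \<le> 1" "x = (1 - u) *\<^sub>R (a - b)"
      by (auto simp: shrink_graph_def)
    then have "(1 - u) *\<^sub>R a + u *\<^sub>R a \<in> K" "(1 - u) *\<^sub>R b + u *\<^sub>R a \<in> K"
      using assms(1) by (intro convexD; simp)+
    moreover have "x = ((1 - u) *\<^sub>R a + u *\<^sub>R a) - ((1 - u) *\<^sub>R b + u *\<^sub>R a)"
      using * by (simp add: algebra_simps)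
    ultimately show False using assms(2) by (auto simp: difference_body_def)
  qed
  then show ?thesis by (simp add: overlap_profile_def)
qed

text \<open>
  The shrunk difference bodies \<open>(1 - u) (K - K)\<close> decrease in \<open>u\<close>, so a representation of \<open>x\<close> for \<open>U\<close>
  yields one for every smaller \<open>u\<close>.
\<close>
lemma overlap_profile_ge:
  fixes K :: "'a::euclidean_space set"
  assumes "convex K" "a \<in> K" "b \<in> K" "0 \<le> U" "U \<le> 1"
  shows "ennreal (U ^ DIM('a)) \<le> overlap_profile K ((1 - U) *\<^sub>R (a - b))"
proof -
  have "((1 - U) *\<^sub>R (a - b), u) \<in> shrink_graph K" if u: "0 \<le> u" "u \<le> U" for u
  proof (cases "u = 1")
    case True
    then show ?thesis using assms u by (force simp: shrink_graph_def)
  next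
    case False
    define s where "s = (1 - U) / (1 - u)"
    have s: "0 \<le> s" "s \<le> 1" "(1 - u) * s = 1 - U" using False u assms by (auto simp: s_def field_simps)
    have "s *\<^sub>R a + (1 - s) *\<^sub>R a \<in> K" "s *\<^sub>R b + (1 - s) *\<^sub>R a \<in> K"
      using assms s by (intro convexD; simp)+
    moreover have "(1 - U) *\<^sub>R (a - b)
        = (1 - u) *\<^sub>R ((s *\<^sub>R a + (1 - s) *\<^sub>R a) - (s *\<^sub>R b + (1 - s) *\<^sub>R a))"
    proof -
      have "(s *\<^sub>R a + (1 - s) *\<^sub>R a) - (s *\<^sub>R b + (1 - s) *\<^sub>R a) = s *\<^sub>R (a - b)"
        by (simp add: algebra_simps)
      then show ?thesis using s(3) by simp
    qed
    ultimately show ?thesis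
      unfolding shrink_graph_def using u assms by fastforce
  qed
  then have "(\<integral>\<^sup>+u. ennreal (real DIM('a) * u ^ (DIM('a) - 1)) * indicator {0..U} u \<partial>lborel)
     \<le> overlap_profile K ((1 - U) *\<^sub>R (a - b))"
    unfolding overlap_profile_def
    by (intro nn_integral_mono mult_left_mono) (auto simp: indicator_def)
  moreover have "(\<integral>\<^sup>+u. ennreal (real DIM('a) * u ^ (DIM('a) - 1)) * indicator {0..U} u \<partial>lborel)
      = ennreal (U ^ DIM('a))"
    using assms by (intro nn_integral_power_derivative) (auto simp: Suc_le_eq)
  ultimately show ?thesis by simp
qed

lemma overlap_profile_le_covariogram:
  fixes K :: "'a::euclidean_space set"
  assumes "convex K" "compact K"
  shows "overlap_profile K x * emeasure lborel K \<le> covariogram K x"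
proof (cases "x \<in> difference_body K")
  case True
  then obtain U a b where *: "0 \<le> U" "U \<le> 1" "a \<in> K" "b \<in> K" "x = (1 - U) *\<^sub>R (a - b)"
    "overlap_profile K x \<le> ennreal (U ^ DIM('a))"
    using overlap_profile_le[OF assms(2)] by metis
  have "overlap_profile K x * emeasure lborel K \<le> ennreal (U ^ DIM('a)) * emeasure lborel K"
    using * by (intro mult_right_mono) auto
  also have "\<dots> \<le> covariogram K x"
    using covariogram_ge_homothet[OF assms *(3,4,1,2)] * by simp
  finally show ?thesis .
next
  case False
  then show ?thesis using overlap_profile_outside[OF assms(1)] by simp
qed

text \<open>
  Integrating \<open>profile * vol K \<le> covariogram\<close> gives
  \<open>vol (K - K) vol K / (2n choose n) \<le> (vol K)\<^sup>2\<close>.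
\<close>
lemma rogers_shephard:
  fixes K :: "'a::euclidean_space set"
  assumes "convex K" "compact K"
  shows "emeasure lborel (difference_body K)
           \<le> of_nat ((2 * DIM('a)) choose DIM('a)) * emeasure lborel K"
proof (cases "interior K = {}")
  case True
  then show ?thesis
    using emeasure_difference_body_empty_interior[OF assms] by simp
next
  case False
  let ?c = "real ((2 * DIM('a)) choose DIM('a))"
  have c: "?c > 0" by simp
  have finK: "emeasure lborel K < \<infinity>" and finD: "emeasure lborel (difference_body K) < \<infinity>"
    using assms compact_difference_body emeasure_compact_finite by auto
  have posK: "emeasure lborel K \<noteq> 0"
    using False assms negligible_convex_interior[of K]
    by (simp add: negligible_iff_emeasure0 borel_compact)
  have "(\<integral>\<^sup>+x. overlap_profile K x * emeasure lborel K \<partial>lborel) \<le> (\<integral>\<^sup>+x. covariogram K x \<partial>lborel)"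
    by (intro nn_integral_mono overlap_profile_le_covariogram assms)
  then have main: "ennreal (1 / ?c) * emeasure lborel (difference_body K) * emeasure lborel K
      \<le> emeasure lborel K * emeasure lborel K"
    using nn_integral_overlap_profile[OF assms(2)] nn_integral_covariogram[OF assms(2)]
    by (simp add: nn_integral_multc)
  have "ennreal (1 / ?c) * emeasure lborel (difference_body K) \<le> emeasure lborel K"
  proof -
    obtain k d where kd: "emeasure lborel K = ennreal k" "0 < k"
        "emeasure lborel (difference_body K) = ennreal d" "0 \<le> d"
      using finK finD posK by (cases "emeasure lborel K"; cases "emeasure lborel (difference_body K)") (auto simp: less_le)
    then have "ennreal (1 / ?c * d * k) \<le> ennreal (k * k)"
      using main by (simp add: ennreal_mult'[symmetric])
    then have "1 / ?c * d * k \<le> k * k" using kd(2) by (subst (asm) ennreal_le_iff) auto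
    then have "1 / ?c * d \<le> k" using kd(2) by (rule mult_right_le_imp_le)
    then show ?thesis using kd by (simp add: ennreal_mult'[symmetric])
  qed
  then have "ennreal ?c * (ennreal (1 / ?c) * emeasure lborel (difference_body K)) \<le> ennreal ?c * emeasure lborel K"
    by (rule mult_left_mono) simp
  then show ?thesis
    using c by (simp add: mult.assoc[symmetric] ennreal_mult[symmetric] ennreal_of_nat_eq_real_of_nat)
qed

text \<open>
  Both implications of the equality case use this: the two sides of the Rogers--Shephard
  inequality are, up to a positive finite factor, the integrals of two functions that are ordered
  pointwise.
\<close>
lemma rogers_shephard_equality_iff_AE:
  fixes K :: "'a::euclidean_space set"
  assumes "convex K" "compact K" "interior K \<noteq> {}"
  shows "emeasure lborel (difference_body K)
           = of_nat ((2 * DIM('a)) choose DIM('a)) * emeasure lborel K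
    \<longleftrightarrow> (AE x in lborel. covariogram K x = overlap_profile K x * emeasure lborel K)"
proof -
  let ?c = "real ((2 * DIM('a)) choose DIM('a))"
  let ?k = "emeasure lborel K" and ?d = "emeasure lborel (difference_body K)"
  have c: "?c > 0" by simp
  have finK: "?k < \<infinity>" and finD: "?d < \<infinity>"
    using assms compact_difference_body emeasure_compact_finite by auto
  have posK: "?k \<noteq> 0"
    using assms negligible_convex_interior[of K]
    by (simp add: negligible_iff_emeasure0 borel_compact)
  note [measurable] = nn_integral_overlap_profile(1)[OF assms(2)] nn_integral_covariogram(1)[OF assms(2)]
  have I1: "(\<integral>\<^sup>+x. overlap_profile K x * ?k \<partial>lborel) = ennreal (1 / ?c) * ?d * ?k"
    using nn_integral_overlap_profile[OF assms(2)] by (simp add: nn_integral_multc)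
  have I2: "(\<integral>\<^sup>+x. covariogram K x \<partial>lborel) = ?k * ?k"
    using nn_integral_covariogram[OF assms(2)] by simp
  have fin1: "(\<integral>\<^sup>+x. overlap_profile K x * ?k \<partial>lborel) \<noteq> \<infinity>"
    unfolding I1 using finK finD by (auto simp: ennreal_mult_eq_top_iff)
  have "(AE x in lborel. covariogram K x = overlap_profile K x * ?k)
      \<longleftrightarrow> (\<integral>\<^sup>+x. overlap_profile K x * ?k \<partial>lborel) = (\<integral>\<^sup>+x. covariogram K x \<partial>lborel)"
  proof
    assume "AE x in lborel. covariogram K x = overlap_profile K x * ?k"
    then show "(\<integral>\<^sup>+x. overlap_profile K x * ?k \<partial>lborel) = (\<integral>\<^sup>+x. covariogram K x \<partial>lborel)"
      by (intro nn_integral_cong_AE) auto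
  next
    assume eq: "(\<integral>\<^sup>+x. overlap_profile K x * ?k \<partial>lborel) = (\<integral>\<^sup>+x. covariogram K x \<partial>lborel)"
    have "AE x in lborel. overlap_profile K x * ?k = covariogram K x"
      using eq fin1 overlap_profile_le_covariogram[OF assms(1,2)]
      by (intro AE_eq_of_nn_integral_eq) auto
    then show "AE x in lborel. covariogram K x = overlap_profile K x * ?k"
      by (rule AE_mp) (intro AE_I2 impI, rule sym)
  qed
  also have "\<dots> \<longleftrightarrow> ennreal (1 / ?c) * ?d * ?k = ?k * ?k"
    unfolding I1 I2 ..
  also have "\<dots> \<longleftrightarrow> ?d = of_nat ((2 * DIM('a)) choose DIM('a)) * ?k"
  proof -
    obtain k d where kd: "?k = ennreal k" "0 < k" "?d = ennreal d" "0 \<le> d"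
      using finK finD posK by (cases ?k; cases ?d) (auto simp: less_le)
    have "ennreal (1 / ?c) * ?d * ?k = ?k * ?k \<longleftrightarrow> 1 / ?c * d * k = k * k"
      using kd by (simp add: ennreal_mult'[symmetric])
    also have "\<dots> \<longleftrightarrow> d = ?c * k"
      using kd(2) c by (simp add: field_simps)
    also have "\<dots> \<longleftrightarrow> ?d = of_nat ((2 * DIM('a)) choose DIM('a)) * ?k"
      using kd by (simp add: ennreal_of_nat_eq_real_of_nat ennreal_mult'[symmetric])
    finally show ?thesis .
  qed
  finally show ?thesis by blast
qed

section \<open>Equality makes overlaps of translates homothetic\<close>

lemma overlap_eq_Int_translation:
  fixes K :: "'a::euclidean_space set"
  shows "{y \<in> K. y - x \<in> K} = K \<inter> (\<lambda>y. x + y) ` K"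
proof (intro set_eqI iffI)
  fix y assume "y \<in> {y \<in> K. y - x \<in> K}"
  then show "y \<in> K \<inter> (\<lambda>y. x + y) ` K"
    by (auto intro: image_eqI[of _ _ "y - x"])
qed auto

lemma convex_overlap:
  fixes K :: "'a::euclidean_space set"
  assumes "convex K" shows "convex {y \<in> K. y - x \<in> K}"
  using assms by (simp add: overlap_eq_Int_translation convex_Int convex_translation)

lemma interior_overlap:
  fixes K :: "'a::euclidean_space set"
  shows "y \<in> interior {y \<in> K. y - x \<in> K} \<longleftrightarrow> y \<in> interior K \<and> y - x \<in> interior K"
proof -
  have "interior {y \<in> K. y - x \<in> K} = interior K \<inter> (\<lambda>y. x + y) ` interior K"
    by (simp add: overlap_eq_Int_translation interior_translation)
  moreover have "y \<in> (\<lambda>y. x + y) ` interior K \<longleftrightarrow> y - x \<in> interior K"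
    by (metis add_diff_cancel_left' diff_add_cancel add.commute image_iff)
  ultimately show ?thesis by blast
qed

text \<open>
  The homothet with the largest admissible ratio lies in the overlap and has the same volume.
\<close>
lemma overlap_eq_homothet_pointwise:
  fixes K :: "'a::euclidean_space set"
  assumes K: "convex K" "compact K"
    and p: "p \<in> interior K" "p - x \<in> interior K"
    and eq: "covariogram K x = overlap_profile K x * emeasure lborel K"
  obtains r a b where "0 \<le> r" "r \<le> 1" "a \<in> K" "b \<in> K" "x = r *\<^sub>R (a - b)"
    "{y \<in> K. y - x \<in> K} = (\<lambda>k. (1 - r) *\<^sub>R k + r *\<^sub>R a) ` K"
proof -
  let ?A = "{y \<in> K. y - x \<in> K}"
  have "p \<in> K" "p - x \<in> K" using p interior_subset by blast+
  then have "x \<in> difference_body K" by (force simp: difference_body_def)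
  then obtain U a b where *: "0 \<le> U" "U \<le> 1" "a \<in> K" "b \<in> K" "x = (1 - U) *\<^sub>R (a - b)"
    "overlap_profile K x \<le> ennreal (U ^ DIM('a))"
    using overlap_profile_le[OF K(2)] by metis
  let ?B = "(\<lambda>k. U *\<^sub>R k + (1 - U) *\<^sub>R a) ` K"
  have clA: "closed ?A" using K by (intro closed_overlap compact_imp_closed)
  have finA: "emeasure lborel ?A < \<infinity>"
    using emeasure_mono[of ?A K lborel] emeasure_compact_finite[OF K(2)] K
    by (auto simp: borel_compact intro: le_less_trans)
  have "?A = ?B"
  proof (rule convex_eq_closed_subset_same_measure)
    show "convex ?A" by (rule convex_overlap[OF K(1)])
    show "interior ?A \<noteq> {}" using p interior_overlap[of p K x] by blast
    have "compact ?B" using K by (intro compact_continuous_image continuous_intros)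
    then show "closed ?B" by (rule compact_imp_closed)
    show "?B \<subseteq> ?A" using homothet_subset_overlap[OF K(1) *(3,4,1,2)] *(5) by simp
    have "emeasure lborel ?A = overlap_profile K x * emeasure lborel K"
      using eq by (simp add: covariogram_def)
    also have "\<dots> \<le> ennreal (U ^ DIM('a)) * emeasure lborel K"
      using * by (intro mult_right_mono) auto
    also have "\<dots> = emeasure lborel ?B" using K * by (simp add: emeasure_homothet)
    finally show "emeasure lborel ?A \<le> emeasure lborel ?B" .
  qed (use clA finA in auto)
  then show ?thesis using that[of "1 - U" a b] * by simp
qed

text \<open>
  Almost every \<open>x\<close> is good by the previous lemma, so a given \<open>x\<close> is a limit of good points
  \<open>X n = r n (a n - b n)\<close>. Along a subsequence \<open>r, a, b\<close> converge, and every interior point of the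
  overlap at \<open>x\<close> lies in the overlaps at \<open>X n\<close> eventually, hence in the limiting homothet.
\<close>
lemma overlap_subset_homothet_of_equality:
  fixes K :: "'a::euclidean_space set"
  assumes K: "convex K" "compact K"
    and eq: "emeasure lborel (difference_body K)
           = of_nat ((2 * DIM('a)) choose DIM('a)) * emeasure lborel K"
    and p: "p \<in> interior K" "p - x \<in> interior K"
  obtains r a b where "0 \<le> r" "r \<le> 1" "a \<in> K" "b \<in> K" "x = r *\<^sub>R (a - b)"
    "{y \<in> K. y - x \<in> K} \<subseteq> (\<lambda>k. (1 - r) *\<^sub>R k + r *\<^sub>R a) ` K"
proof -
  have ne: "interior K \<noteq> {}" using p by blast
  have AE: "AE x in lborel. covariogram K x = overlap_profile K x * emeasure lborel K"
    using rogers_shephard_equality_iff_AE[OF K ne] eq by simp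
  define good where "good n q \<longleftrightarrow> (case q of (x', r, a, b) \<Rightarrow>
      dist x x' < 1 / real (Suc n) \<and> 0 \<le> r \<and> r \<le> 1 \<and> a \<in> K \<and> b \<in> K \<and> x' = r *\<^sub>R (a - b)
      \<and> {y \<in> K. y - x' \<in> K} = (\<lambda>k. (1 - r) *\<^sub>R k + r *\<^sub>R a) ` K)" for n :: nat and q
  have "\<exists>q. good n q" for n
  proof -
    have "open ((\<lambda>x. p - x) -` interior K)"
      by (intro open_vimage continuous_intros) auto
    then have "open (ball x (1 / real (Suc n)) \<inter> (\<lambda>x. p - x) -` interior K)" by blast
    moreover have "x \<in> ball x (1 / real (Suc n)) \<inter> (\<lambda>x. p - x) -` interior K"
      using p by simp
    ultimately obtain x' where x': "x' \<in> ball x (1 / real (Suc n)) \<inter> (\<lambda>x. p - x) -` interior K"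
      "covariogram K x' = overlap_profile K x' * emeasure lborel K"
      using AE_lborel_meets_open[OF AE] by (metis empty_iff)
    then have pint: "p - x' \<in> interior K" by simp
    obtain r a b where rab: "0 \<le> r" "r \<le> 1" "a \<in> K" "b \<in> K" "x' = r *\<^sub>R (a - b)"
      "{y \<in> K. y - x' \<in> K} = (\<lambda>k. (1 - r) *\<^sub>R k + r *\<^sub>R a) ` K"
      by (rule overlap_eq_homothet_pointwise[OF K p(1) pint x'(2)])
    have "dist x x' < 1 / real (Suc n)" using x'(1) by simp
    then have "good n (x', r, a, b)" unfolding good_def prod.case using rab by (intro conjI)
    then show ?thesis ..
  qed
  then obtain q where q: "\<And>n. good n (q n)" by metis
  define X r a b where "X n = fst (q n)" and "r n = fst (snd (q n))"
    and "a n = fst (snd (snd (q n)))" and "b n = snd (snd (snd (q n)))" for n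
  have qn: "q n = (X n, r n, a n, b n)" for n by (simp add: X_def r_def a_def b_def)
  have X: "\<And>n. dist x (X n) < 1 / real (Suc n)"
    and rab: "\<And>n. 0 \<le> r n" "\<And>n. r n \<le> 1" "\<And>n. a n \<in> K" "\<And>n. b n \<in> K"
      "\<And>n. X n = r n *\<^sub>R (a n - b n)"
    and ov: "\<And>n. {y \<in> K. y - X n \<in> K} = (\<lambda>k. (1 - r n) *\<^sub>R k + r n *\<^sub>R a n) ` K"
    using q[unfolded qn good_def prod.case] by blast+
  have cmp: "compact ({0..1::real} \<times> K \<times> K)" using K by (intro compact_Times) auto
  have mem: "\<forall>n. (r n, a n, b n) \<in> {0..1} \<times> K \<times> K" using rab(1-4) by simp
  obtain L \<phi> where L: "L \<in> {0..1} \<times> K \<times> K" "strict_mono \<phi>"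
    "((\<lambda>n. (r n, a n, b n)) \<circ> \<phi>) \<longlonglongrightarrow> L"
    by (rule seq_compactE[OF compact_imp_seq_compact[OF cmp] mem])
  obtain r' a' b' where L': "L = (r', a', b')" by (cases L)
  have lim: "(\<lambda>n. r (\<phi> n)) \<longlonglongrightarrow> r'" "(\<lambda>n. a (\<phi> n)) \<longlonglongrightarrow> a'" "(\<lambda>n. b (\<phi> n)) \<longlonglongrightarrow> b'"
    using tendsto_fst[OF L(3)] tendsto_fst[OF tendsto_snd[OF L(3)]] tendsto_snd[OF tendsto_snd[OF L(3)]]
    by (simp_all add: L' o_def)
  have "X \<longlonglongrightarrow> x"
  proof (rule metric_LIMSEQ_I)
    fix e :: real assume "e > 0"
    then obtain N where N: "1 / real (Suc N) < e"
      using nat_approx_posE by blast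
    have "dist (X n) x < e" if "n \<ge> N" for n
    proof -
      have "1 / real (Suc n) \<le> 1 / real (Suc N)" using that by (simp add: field_simps)
      then show ?thesis using X[of n] N by (simp add: dist_commute)
    qed
    then show "\<exists>N. \<forall>n\<ge>N. dist (X n) x < e" by blast
  qed
  then have X\<phi>: "(\<lambda>n. X (\<phi> n)) \<longlonglongrightarrow> x"
    using LIMSEQ_subseq_LIMSEQ[OF _ L(2)] by (auto simp: o_def)
  moreover have "(\<lambda>n. X (\<phi> n)) \<longlonglongrightarrow> r' *\<^sub>R (a' - b')"
    unfolding rab(5) by (intro tendsto_intros lim)
  ultimately have x: "x = r' *\<^sub>R (a' - b')" using LIMSEQ_unique by blast
  let ?A = "{y \<in> K. y - x \<in> K}" and ?B = "(\<lambda>k. (1 - r') *\<^sub>R k + r' *\<^sub>R a') ` K"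
  \<comment> \<open>Compactness of this set passes the membership in the homothet to the limit for every y at once.\<close>
  define E where "E = (\<lambda>(r, a, k). (r, a, (1 - r) *\<^sub>R k + r *\<^sub>R a)) ` ({0..1} \<times> K \<times> K)"
  have "compact E"
    unfolding E_def using K
    by (intro compact_continuous_image compact_Times) (auto intro!: continuous_intros simp: case_prod_unfold)
  then have "closed E" by (rule compact_imp_closed)
  have int: "interior ?A \<subseteq> ?B"
  proof
    fix y assume "y \<in> interior ?A"
    then have y: "y \<in> K" "y - x \<in> interior K"
      using interior_overlap[of y K x] interior_subset by blast+
    have "(\<lambda>n. y - X (\<phi> n)) \<longlonglongrightarrow> y - x" by (intro tendsto_intros X\<phi>)
    then have "\<forall>\<^sub>F n in sequentially. y - X (\<phi> n) \<in> interior K"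
      using topological_tendstoD[OF _ open_interior y(2)] by blast
    then have ev: "\<forall>\<^sub>F n in sequentially. (r (\<phi> n), a (\<phi> n), y) \<in> E"
    proof (rule eventually_mono)
      fix n assume "y - X (\<phi> n) \<in> interior K"
      then have "y \<in> {y \<in> K. y - X (\<phi> n) \<in> K}" using y(1) interior_subset by blast
      then obtain k where "k \<in> K" "y = (1 - r (\<phi> n)) *\<^sub>R k + r (\<phi> n) *\<^sub>R a (\<phi> n)"
        using ov[of "\<phi> n"] by auto
      then show "(r (\<phi> n), a (\<phi> n), y) \<in> E"
        unfolding E_def using rab by (intro image_eqI[of _ _ "(r (\<phi> n), a (\<phi> n), k)"]) auto
    qed
    have "(\<lambda>n. (r (\<phi> n), a (\<phi> n), y)) \<longlonglongrightarrow> (r', a', y)"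
      by (intro tendsto_intros lim)
    then have "(r', a', y) \<in> E"
      by (rule Lim_in_closed_set[OF \<open>closed E\<close> ev sequentially_bot])
    then obtain q where q: "(r', a', y) = (\<lambda>(r, a, k). (r, a, (1 - r) *\<^sub>R k + r *\<^sub>R a)) q"
      "q \<in> {0..1} \<times> K \<times> K" unfolding E_def by (rule imageE)
    obtain r'' a'' k where "q = (r'', a'', k)" by (rule prod_cases3)
    then have "k \<in> K" "y = (1 - r') *\<^sub>R k + r' *\<^sub>R a'" using q by simp_all
    then show "y \<in> ?B" by (rule rev_image_eqI)
  qed
  have "closed ?A" using K by (intro closed_overlap compact_imp_closed)
  moreover have "interior ?A \<noteq> {}" using p interior_overlap[of p K x] by blast
  ultimately have "closure (interior ?A) = ?A"
    using convex_closure_interior[OF convex_overlap[OF K(1)], of x] closure_closed[of ?A] by simp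
  moreover have "closed ?B"
    using K by (intro compact_imp_closed compact_continuous_image continuous_intros)
  ultimately have "?A \<subseteq> ?B" using closure_minimal[OF int] by simp
  moreover have "0 \<le> r'" "r' \<le> 1" "a' \<in> K" "b' \<in> K" using L(1) by (simp_all add: L')
  ultimately show ?thesis using x by (intro that[of r' a' b'])
qed

section \<open>Homothetic overlaps make the extreme points affinely independent\<close>

lemma extreme_point_eq_of_convex_combination:
  assumes "v extreme_point_of K" "a \<in> K" "b \<in> K" "0 < t" "t < 1"
    "v = (1 - t) *\<^sub>R a + t *\<^sub>R b"
  shows "a = v \<and> b = v"
proof (cases "a = b")
  case True
  then show ?thesis using assms(6) by (simp add: algebra_simps)
next
  case False
  then have "v \<in> open_segment a b" using assms by (auto simp: in_segment)
  then show ?thesis using assms(1-3) by (auto simp: extreme_point_of_def)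
qed

text \<open>
  Extremality identifies the homothet. It is some \<open>(1 - s) K + s a\<close> with \<open>r (v - w) = s (a - b)\<close>,
  it contains \<open>v\<close>, and its translate by \<open>r (w - v)\<close> contains \<open>w\<close>. Since \<open>v\<close> and \<open>w\<close> are extreme, this
  gives \<open>a = v\<close> and \<open>b = w\<close>, so \<open>s = r\<close>.
\<close>
lemma overlap_at_extreme_points:
  fixes K :: "'a::euclidean_space set"
  assumes K: "convex K" "compact K" "interior K \<noteq> {}"
    and eq: "emeasure lborel (difference_body K)
           = of_nat ((2 * DIM('a)) choose DIM('a)) * emeasure lborel K"
    and v: "v extreme_point_of K" and w: "w extreme_point_of K" and "v \<noteq> w" "0 < r" "r < 1"
    and y: "y \<in> K" "y - r *\<^sub>R (v - w) \<in> K"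
  shows "\<exists>k\<in>K. y = (1 - r) *\<^sub>R k + r *\<^sub>R v"
proof -
  let ?x = "r *\<^sub>R (v - w)"
  have vw: "v \<in> K" "w \<in> K" using v w by (auto simp: extreme_point_of_def)
  obtain c where c: "c \<in> interior K" using K(3) by blast
  \<comment> \<open>Shrinking towards v and towards w turns the interior point c into a common interior point of the overlapping translates.\<close>
  have shift: "(1 - r) *\<^sub>R c + r *\<^sub>R u \<in> interior K" if "u \<in> K" for u
  proof -
    have "u - (1 - r) *\<^sub>R (u - c) \<in> interior K"
      using \<open>0 < r\<close> \<open>r < 1\<close> by (intro mem_interior_convex_shrink K c that) auto
    then show ?thesis by (simp add: algebra_simps)
  qed
  have p: "(1 - r) *\<^sub>R c + r *\<^sub>R v \<in> interior K" by (rule shift[OF vw(1)])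
  have p': "(1 - r) *\<^sub>R c + r *\<^sub>R v - ?x \<in> interior K"
    using shift[OF vw(2)] by (simp add: algebra_simps)
  obtain s a b where s: "0 \<le> s" "s \<le> 1" "a \<in> K" "b \<in> K" "?x = s *\<^sub>R (a - b)"
    "{y \<in> K. y - ?x \<in> K} \<subseteq> (\<lambda>k. (1 - s) *\<^sub>R k + s *\<^sub>R a) ` K"
    by (rule overlap_subset_homothet_of_equality[OF K(1,2) eq p p'])
  have "s \<noteq> 0" using s(5) \<open>v \<noteq> w\<close> \<open>0 < r\<close> by auto
  \<comment> \<open>Ratio 0 would leave a single point, but the overlap has interior.\<close>
  have "s \<noteq> 1"
  proof
    assume "s = 1"
    then have "{y \<in> K. y - ?x \<in> K} \<subseteq> {a}" using s(6) by auto
    then have "interior {y \<in> K. y - ?x \<in> K} \<subseteq> interior {a}" by (rule interior_mono)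
    then show False using interior_overlap[of _ K ?x] p p' by auto
  qed
  have s01: "0 < s" "s < 1" using s \<open>s \<noteq> 0\<close> \<open>s \<noteq> 1\<close> by auto
  have "v - ?x \<in> K"
  proof -
    have "(1 - r) *\<^sub>R v + r *\<^sub>R w \<in> K" using vw K \<open>0 < r\<close> \<open>r < 1\<close> by (intro convexD) auto
    then show ?thesis by (simp add: algebra_simps)
  qed
  then obtain k where k: "k \<in> K" "v = (1 - s) *\<^sub>R k + s *\<^sub>R a" using s(6) vw by blast
  then have a: "a = v" using extreme_point_eq_of_convex_combination[OF v k(1) s(3) s01] by blast
  have "w + ?x \<in> K"
  proof -
    have "(1 - r) *\<^sub>R w + r *\<^sub>R v \<in> K" using vw K \<open>0 < r\<close> \<open>r < 1\<close> by (intro convexD) auto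
    then show ?thesis by (simp add: algebra_simps)
  qed
  moreover have "w + ?x - ?x \<in> K" using vw by simp
  ultimately obtain k' where k': "k' \<in> K" "w + ?x = (1 - s) *\<^sub>R k' + s *\<^sub>R a" using s(6) by blast
  have "w = (w + ?x) - ?x" by simp
  also have "\<dots> = ((1 - s) *\<^sub>R k' + s *\<^sub>R a) - s *\<^sub>R (a - b)" unfolding k'(2) unfolding s(5) ..
  also have "\<dots> = (1 - s) *\<^sub>R k' + s *\<^sub>R b" by (simp add: algebra_simps)
  finally have "w = (1 - s) *\<^sub>R k' + s *\<^sub>R b" .
  then have b: "b = w" using extreme_point_eq_of_convex_combination[OF w k'(1) s(4) s01] by blast
  have "(r - s) *\<^sub>R (v - w) = 0" using s(5) a b by (simp add: algebra_simps)
  then have "s = r" using \<open>v \<noteq> w\<close> by simp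
  then show ?thesis using s(6) a y by blast
qed

text \<open>
  The slice at height \<open>h\<close> of the cone over \<open>K\<close>. For points at heights \<open>h\<close> and \<open>h'\<close>, membership of
  \<open>x - x'\<close> in \<open>dilate (h - h') K\<close> is the cone order, and \<open>dilate_add\<close> says that the cone is closed
  under addition.
\<close>
definition dilate :: "real \<Rightarrow> 'a::euclidean_space set \<Rightarrow> 'a set" where
  "dilate h K = (\<lambda>k. h *\<^sub>R k) ` K"

lemma dilate_add:
  assumes "convex K" "0 \<le> s" "0 \<le> t" "x \<in> dilate s K" "y \<in> dilate t K"
  shows "x + y \<in> dilate (s + t) K"
proof (cases "s + t = 0")
  case True
  then have "s = 0" "t = 0" using assms by auto
  then show ?thesis using assms by (auto simp: dilate_def)
next
  case False
  obtain a b where ab: "a \<in> K" "b \<in> K" "x = s *\<^sub>R a" "y = t *\<^sub>R b" using assms by (auto simp: dilate_def)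
  have "(s / (s + t)) *\<^sub>R a + (t / (s + t)) *\<^sub>R b \<in> K"
    using assms ab False by (intro convexD) (auto simp: add_divide_distrib[symmetric])
  moreover have "x + y = (s + t) *\<^sub>R ((s / (s + t)) *\<^sub>R a + (t / (s + t)) *\<^sub>R b)"
    using False ab by (simp add: scaleR_add_right)
  ultimately show ?thesis by (auto simp: dilate_def)
qed

text \<open>
  A point of height \<open>h\<close> that lies above both \<open>\<beta> v\<close> and \<open>\<beta> w\<close> in the cone order lies above their
  sum. After scaling by \<open>1 / (h - \<beta>)\<close> this is the inclusion of \<open>overlap_at_extreme_points\<close>.
\<close>
lemma cone_meet_of_extreme_points:
  fixes K :: "'a::euclidean_space set"
  assumes K: "convex K" "compact K" "interior K \<noteq> {}"
    and eq: "emeasure lborel (difference_body K)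
           = of_nat ((2 * DIM('a)) choose DIM('a)) * emeasure lborel K"
    and v: "v extreme_point_of K" and w: "w extreme_point_of K" and "v \<noteq> w"
    and \<beta>: "0 < \<beta>" "2 * \<beta> < h"
    and y: "y - \<beta> *\<^sub>R v \<in> dilate (h - \<beta>) K" "y - \<beta> *\<^sub>R w \<in> dilate (h - \<beta>) K"
  shows "y - \<beta> *\<^sub>R v - \<beta> *\<^sub>R w \<in> dilate (h - 2 * \<beta>) K"
proof -
  define t where "t = h - \<beta>"
  define r where "r = \<beta> / t"
  have t: "t > 0" "\<beta> < t" using \<beta> by (auto simp: t_def)
  have r: "0 < r" "r < 1" using t \<beta> by (auto simp: r_def)
  obtain k1 k2 where k: "k1 \<in> K" "k2 \<in> K" "y - \<beta> *\<^sub>R v = t *\<^sub>R k1" "y - \<beta> *\<^sub>R w = t *\<^sub>R k2"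
    using y by (auto simp: dilate_def t_def)
  have tr: "t * r = \<beta>" using t by (simp add: r_def)
  have "t *\<^sub>R (k2 - r *\<^sub>R (v - w)) = t *\<^sub>R k2 - (t * r) *\<^sub>R (v - w)"
    by (simp add: scaleR_diff_right)
  also have "\<dots> = t *\<^sub>R k1" using k tr by (simp add: algebra_simps)
  finally have "k2 - r *\<^sub>R (v - w) = k1" using t by simp
  then obtain q where q: "q \<in> K" "k2 = (1 - r) *\<^sub>R q + r *\<^sub>R v"
    using overlap_at_extreme_points[OF K eq v w \<open>v \<noteq> w\<close> r k(2)] k(1) by blast
  have "y - \<beta> *\<^sub>R v - \<beta> *\<^sub>R w = t *\<^sub>R k2 - \<beta> *\<^sub>R v" using k(4) by (simp add: algebra_simps)
  also have "\<dots> = (t * (1 - r)) *\<^sub>R q + (t * r) *\<^sub>R v - \<beta> *\<^sub>R v" unfolding q(2) by (simp add: scaleR_add_right)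
  also have "\<dots> = (h - 2 * \<beta>) *\<^sub>R q" unfolding tr using tr by (simp add: t_def algebra_simps)
  finally show ?thesis using q by (auto simp: dilate_def)
qed

text \<open>
  Some positive multiple of \<open>w\<close> is below \<open>q\<close> in the order of the cone over \<open>K\<close>.
\<close>
definition has_component :: "'a::euclidean_space set \<Rightarrow> 'a \<Rightarrow> 'a \<Rightarrow> bool" where
  "has_component K w q \<longleftrightarrow> (\<exists>\<beta>>0. \<beta> < 1 \<and> q - \<beta> *\<^sub>R w \<in> dilate (1 - \<beta>) K)"

lemma has_component_smaller:
  assumes "convex K" "w \<in> K" "q - \<beta> *\<^sub>R w \<in> dilate (1 - \<beta>) K" "0 \<le> \<gamma>" "\<gamma> \<le> \<beta>" "\<beta> \<le> 1"
  shows "q - \<gamma> *\<^sub>R w \<in> dilate (1 - \<gamma>) K"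
proof -
  have "(\<beta> - \<gamma>) *\<^sub>R w \<in> dilate (\<beta> - \<gamma>) K" using assms(2) by (auto simp: dilate_def)
  then have "(q - \<beta> *\<^sub>R w) + (\<beta> - \<gamma>) *\<^sub>R w \<in> dilate ((1 - \<beta>) + (\<beta> - \<gamma>)) K"
    using assms by (intro dilate_add) auto
  then show ?thesis by (simp add: algebra_simps)
qed

text \<open>
  Remove \<open>t v\<close> from \<open>t v + (1 - t) q\<close> in \<open>N\<close> steps of size \<open>\<beta> = t / N\<close>. If \<open>\<beta>\<close> is small enough, each
  intermediate point is above \<open>\<beta> v\<close> and above \<open>\<beta> w\<close>, hence above their sum, so that \<open>\<beta> w\<close> survives
  the removal of \<open>\<beta> v\<close>.
\<close>
lemma has_component_of_join:
  fixes K :: "'a::euclidean_space set"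
  assumes K: "convex K" "compact K" "interior K \<noteq> {}"
    and eq: "emeasure lborel (difference_body K)
           = of_nat ((2 * DIM('a)) choose DIM('a)) * emeasure lborel K"
    and v: "v extreme_point_of K" and w: "w extreme_point_of K" and "v \<noteq> w"
    and q: "q \<in> K" and t: "0 \<le> t" "t < 1"
    and c: "has_component K w (t *\<^sub>R v + (1 - t) *\<^sub>R q)"
  shows "has_component K w q"
proof (cases "t = 0")
  case True
  then show ?thesis using c by simp
next
  case False
  then have t0: "0 < t" using t by simp
  let ?p = "t *\<^sub>R v + (1 - t) *\<^sub>R q"
  have vw: "v \<in> K" "w \<in> K" using v w by (auto simp: extreme_point_of_def)
  obtain \<beta>0 where \<beta>0: "0 < \<beta>0" "\<beta>0 < 1" "?p - \<beta>0 *\<^sub>R w \<in> dilate (1 - \<beta>0) K"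
    using c by (auto simp: has_component_def)
  \<comment> \<open>The bound 1 - t keeps the height above twice the step during the whole removal.\<close>
  define \<mu> where "\<mu> = min \<beta>0 (1 - t)"
  have \<mu>: "\<mu> > 0" "\<mu> \<le> \<beta>0" "\<mu> \<le> 1 - t" using \<beta>0 t by (auto simp: \<mu>_def)
  obtain N :: nat where N: "t / \<mu> < real N" using reals_Archimedean2 by blast
  define \<beta> where "\<beta> = t / real N"
  have Npos: "real N > 0"
    using N \<mu>(1) t0 by (meson divide_pos_pos less_trans)
  have "\<beta> < \<mu>" using N Npos \<mu>(1) by (simp add: \<beta>_def field_simps)
  then have \<beta>: "0 < \<beta>" "\<beta> < \<beta>0" "\<beta> < 1 - t" "real N * \<beta> = t"
    using Npos t0 \<mu> by (auto simp: \<beta>_def)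
  have "?p - (real j * \<beta>) *\<^sub>R v - \<beta> *\<^sub>R w \<in> dilate (1 - real j * \<beta> - \<beta>) K" if "j \<le> N" for j
    using that
  proof (induction j)
    case 0
    show ?case
      using has_component_smaller[OF K(1) vw(2) \<beta>0(3), of \<beta>] \<beta> \<beta>0 by simp
  next
    case (Suc j)
    let ?y = "?p - (real j * \<beta>) *\<^sub>R v" and ?h = "1 - real j * \<beta>"
    have Sj: "real (Suc j) * \<beta> \<le> t"
    proof -
      have "real (Suc j) * \<beta> \<le> real N * \<beta>" using Suc.prems \<beta>(1) by (intro mult_right_mono) auto
      then show ?thesis using \<beta>(4) by simp
    qed
    have h: "2 * \<beta> < ?h" using Sj \<beta> by (simp add: algebra_simps)
    have "?y - \<beta> *\<^sub>R v \<in> dilate (?h - \<beta>) K"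
    proof -
      have "(t - real (Suc j) * \<beta>) *\<^sub>R v \<in> dilate (t - real (Suc j) * \<beta>) K" using vw by (auto simp: dilate_def)
      moreover have "(1 - t) *\<^sub>R q \<in> dilate (1 - t) K" using q by (auto simp: dilate_def)
      ultimately have "(t - real (Suc j) * \<beta>) *\<^sub>R v + (1 - t) *\<^sub>R q \<in> dilate ((t - real (Suc j) * \<beta>) + (1 - t)) K"
        using K Sj t by (intro dilate_add) auto
      then show ?thesis by (simp add: algebra_simps)
    qed
    moreover have "?y - \<beta> *\<^sub>R w \<in> dilate (?h - \<beta>) K" using Suc by simp
    ultimately have "?y - \<beta> *\<^sub>R v - \<beta> *\<^sub>R w \<in> dilate (?h - 2 * \<beta>) K"
      by (intro cone_meet_of_extreme_points[OF K eq v w \<open>v \<noteq> w\<close> \<beta>(1) h])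
    then show ?case by (simp add: algebra_simps)
  qed
  from this[of N] have "(1 - t) *\<^sub>R q - \<beta> *\<^sub>R w \<in> dilate (1 - t - \<beta>) K" using \<beta>(4) by simp
  then obtain k where k: "k \<in> K" "(1 - t) *\<^sub>R q - \<beta> *\<^sub>R w = (1 - t - \<beta>) *\<^sub>R k" by (auto simp: dilate_def)
  let ?g = "\<beta> / (1 - t)"
  have "(1 - t) *\<^sub>R (q - ?g *\<^sub>R w) = (1 - t) *\<^sub>R ((1 - ?g) *\<^sub>R k)"
    using k(2) t by (simp add: scaleR_diff_right right_diff_distrib)
  then have "q - ?g *\<^sub>R w = (1 - ?g) *\<^sub>R k" using t by (simp only: scaleR_cancel_left) simp
  moreover have "0 < ?g" "?g < 1" using \<beta> t by auto
  ultimately show ?thesis unfolding has_component_def dilate_def using k(1) by blast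
qed

text \<open>
  An extreme point \<open>v \<noteq> w\<close> has no component along \<open>w\<close>, and by \<open>has_component_of_join\<close> this property
  passes from \<open>q\<close> to the points between \<open>v\<close> and \<open>q\<close>.
\<close>
lemma convex_hull_of_extreme_points_no_component:
  fixes K :: "'a::euclidean_space set"
  assumes K: "convex K" "compact K" "interior K \<noteq> {}"
    and eq: "emeasure lborel (difference_body K)
           = of_nat ((2 * DIM('a)) choose DIM('a)) * emeasure lborel K"
    and w: "w extreme_point_of K"
    and "finite M" "\<And>v. v \<in> M \<Longrightarrow> v extreme_point_of K" "w \<notin> M"
    and "q \<in> convex hull M"
  shows "\<not> has_component K w q"
  using assms(6-)
proof (induction M arbitrary: q rule: finite_induct)
  case empty
  then show ?case by simp
next
  case (insert v M)
  have v: "v extreme_point_of K" and vw: "v \<noteq> w" using insert.prems by auto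
  have nv: "\<not> has_component K w v"
  proof
    assume "has_component K w v"
    then obtain \<beta> k where "0 < \<beta>" "\<beta> < 1" "k \<in> K" "v - \<beta> *\<^sub>R w = (1 - \<beta>) *\<^sub>R k"
      by (auto simp: has_component_def dilate_def)
    then show False
      using extreme_point_eq_of_convex_combination[OF v, of k w \<beta>] w vw
      by (auto simp: extreme_point_of_def algebra_simps)
  qed
  show ?case
  proof (cases "M = {}")
    case True
    then show ?thesis using insert.prems nv by simp
  next
    case False
    then obtain a b q' where ab: "0 \<le> a" "0 \<le> b" "a + b = 1" "q' \<in> convex hull M" "q = a *\<^sub>R v + b *\<^sub>R q'"
      using insert.prems(3) convex_hull_insert[OF False, of v] by auto
    show ?thesis
    proof (cases "a = 1")
      case True
      then show ?thesis using ab nv by simp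
    next
      case False
      have "M \<subseteq> K" using insert.prems by (auto simp: extreme_point_of_def)
      then have q': "q' \<in> K" using ab(4) K(1) hull_minimal by blast
      have "\<not> has_component K w q'" using insert.IH insert.prems ab(4) by blast
      moreover have "b = 1 - a" using ab by simp
      ultimately show ?thesis
        using has_component_of_join[OF K eq v w vw q', of a] ab(1,3,5) False ab(2) \<open>b = 1 - a\<close>
        by (metis less_eq_real_def diff_gt_0_iff_gt diff_ge_0_iff_ge)
    qed
  qed
qed

text \<open>
  An affine dependence gives, by Radon's theorem, a point in the convex hulls of two disjoint sets
  of extreme points. It has a component along some member of the second set, contrary to its
  membership in the hull of the first.
\<close>
lemma extreme_points_affine_independent:
  fixes K :: "'a::euclidean_space set"
  assumes K: "convex K" "compact K" "interior K \<noteq> {}"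
    and eq: "emeasure lborel (difference_body K)
           = of_nat ((2 * DIM('a)) choose DIM('a)) * emeasure lborel K"
    and C: "finite C" "\<And>v. v \<in> C \<Longrightarrow> v extreme_point_of K"
  shows "\<not> affine_dependent C"
proof
  assume "affine_dependent C"
  then obtain M P where MP: "M \<inter> P = {}" "M \<union> P = C" "convex hull M \<inter> convex hull P \<noteq> {}"
    using Radon_partition[OF C(1)] by blast
  then obtain q where q: "q \<in> convex hull M" "q \<in> convex hull P" by blast
  have fin: "finite M" "finite P" using C(1) MP(2) by (metis finite_Un)+
  have PK: "P \<subseteq> K" using C MP by (auto simp: extreme_point_of_def)
  obtain u where u: "\<And>x. x \<in> P \<Longrightarrow> 0 \<le> u x" "sum u P = 1" "(\<Sum>x\<in>P. u x *\<^sub>R x) = q"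
    using q(2) convex_hull_finite[OF fin(2)] by auto
  have "\<exists>w\<in>P. u w > 0"
  proof (rule ccontr)
    assume "\<not> ?thesis"
    then have "u w = 0" if "w \<in> P" for w using u(1)[OF that] that by force
    then show False using u(2) by simp
  qed
  then obtain w where w: "w \<in> P" "u w > 0" by blast
  have le1: "u w \<le> 1" using member_le_sum[of w P u] u(1,2) w(1) fin(2) by auto
  have rest: "q - u w *\<^sub>R w \<in> dilate (1 - u w) K"
  proof -
    have split: "u w + sum u (P - {w}) = 1" using u(2) w fin by (simp add: sum.remove)
    have q': "q - u w *\<^sub>R w = (\<Sum>x\<in>P - {w}. u x *\<^sub>R x)" using u(3) w fin by (auto simp: sum.remove)
    have gen: "(\<Sum>x\<in>S. u x *\<^sub>R x) \<in> dilate (sum u S) K" if "finite S" "S \<subseteq> P" for S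
      using that
    proof (induction S rule: finite_induct)
      case empty
      then show ?case using K(3) interior_subset[of K] by (auto simp: dilate_def)
    next
      case (insert x S)
      have "u x *\<^sub>R x \<in> dilate (u x) K" using insert.prems PK by (auto simp: dilate_def)
      then have "u x *\<^sub>R x + (\<Sum>x\<in>S. u x *\<^sub>R x) \<in> dilate (u x + sum u S) K"
        using insert u(1) K(1) by (intro dilate_add sum_nonneg) auto
      then show ?case using insert by simp
    qed
    have "sum u (P - {w}) = 1 - u w" using split by simp
    then show ?thesis unfolding q' using gen[of "P - {w}"] fin by simp
  qed
  \<comment> \<open>Halving keeps the multiple below 1 when w is the only point with positive weight.\<close>
  define \<gamma> where "\<gamma> = u w / 2"
  have "q - \<gamma> *\<^sub>R w \<in> dilate (1 - \<gamma>) K"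
    using w(2) le1 PK w(1) by (intro has_component_smaller[OF K(1) _ rest]) (auto simp: \<gamma>_def)
  moreover have "0 < \<gamma>" "\<gamma> < 1" using w(2) le1 by (auto simp: \<gamma>_def)
  ultimately have "has_component K w q" by (auto simp: has_component_def)
  moreover have "\<not> has_component K w q"
    using C MP w(1) q(1) fin
    by (intro convex_hull_of_extreme_points_no_component[OF K eq, where M = M]) auto
  ultimately show False by blast
qed

text \<open>
  There are at most \<open>n + 1\<close> extreme points by affine independence, and they span \<open>K\<close> by the theorem
  of Minkowski, so that full dimension makes their number exactly \<open>n + 1\<close>.
\<close>
lemma simplex_of_rogers_shephard_equality:
  fixes K :: "'a::euclidean_space set"
  assumes K: "convex K" "compact K" "interior K \<noteq> {}"
    and eq: "emeasure lborel (difference_body K)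
           = of_nat ((2 * DIM('a)) choose DIM('a)) * emeasure lborel K"
  shows "int DIM('a) simplex K"
proof -
  let ?E = "{x. x extreme_point_of K}"
  have ind: "\<not> affine_dependent C" if "finite C" "C \<subseteq> ?E" for C
    using extreme_points_affine_independent[OF K eq that(1)] that(2) by blast
  have "finite ?E"
  proof (rule ccontr)
    assume "infinite ?E"
    then obtain C where C: "C \<subseteq> ?E" "finite C" "card C = DIM('a) + 2"
      using infinite_arbitrarily_large by blast
    then show False using ind[OF C(2,1)] affine_dependent_biggerset[OF C(2)] by simp
  qed
  then have aff: "\<not> affine_dependent ?E" using ind by blast
  have hull: "K = convex hull ?E" by (rule Krein_Milman_Minkowski[OF K(2,1)])
  have "aff_dim ?E = aff_dim K" by (subst (2) hull) (rule aff_dim_convex_hull[symmetric])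
  also have "\<dots> = DIM('a)" by (rule aff_dim_nonempty_interior[OF K(3)])
  finally have "int (card ?E) = int DIM('a) + 1" using aff_dim_affine_independent[OF aff] by simp
  then show ?thesis unfolding simplex_def using aff hull by blast
qed

section \<open>Simplices attain equality\<close>

text \<open>
  Let \<open>f\<close> and \<open>g\<close> be the barycentric coordinates of \<open>p\<close> and \<open>p - x\<close>, and \<open>m\<close> their minimum. A point of
  the overlap has coordinates at least \<open>max 0 (f - g) = f - m\<close>. So the ratio of the homothet is
  \<open>U = \<Sum> m\<close>, and \<open>a\<close> and \<open>b\<close> are the normalized remainders \<open>f - m\<close> and \<open>g - m\<close>.
\<close>
lemma simplex_overlap_subset_homothet:
  fixes C :: "'a::euclidean_space set"
  assumes C: "\<not> affine_dependent C" "K = convex hull C"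
    and p: "p \<in> K" "p - x \<in> K"
  obtains U a b where "0 \<le> U" "U \<le> 1" "a \<in> K" "b \<in> K" "x = (1 - U) *\<^sub>R (a - b)"
    "{y \<in> K. y - x \<in> K} \<subseteq> (\<lambda>k. U *\<^sub>R k + (1 - U) *\<^sub>R a) ` K"
proof -
  have fin: "finite C" by (rule aff_independent_finite[OF C(1)])
  have hull: "K = {y. \<exists>u. (\<forall>x\<in>C. 0 \<le> u x) \<and> sum u C = 1 \<and> (\<Sum>x\<in>C. u x *\<^sub>R x) = y}"
    using C(2) convex_hull_finite[OF fin] by simp
  have inK: "(\<Sum>v\<in>C. (f v / m) *\<^sub>R v) \<in> K" if "\<And>v. v \<in> C \<Longrightarrow> 0 \<le> f v" "sum f C = m" "m > 0" for f m
    unfolding hull using that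
    by (auto intro!: exI[of _ "\<lambda>v. f v / m"] simp: sum_divide_distrib[symmetric])
  obtain f where f: "\<And>v. v \<in> C \<Longrightarrow> 0 \<le> f v" "sum f C = 1" "(\<Sum>v\<in>C. f v *\<^sub>R v) = p"
    using p(1) unfolding hull by blast
  obtain g where g: "\<And>v. v \<in> C \<Longrightarrow> 0 \<le> g v" "sum g C = 1" "(\<Sum>v\<in>C. g v *\<^sub>R v) = p - x"
    using p(2) unfolding hull by blast
  define m where "m v = min (f v) (g v)" for v
  define U where "U = sum m C"
  have m0: "0 \<le> m v" if "v \<in> C" for v using f(1) g(1) that by (simp add: m_def)
  have U0: "0 \<le> U" unfolding U_def using m0 by (intro sum_nonneg)
  have sf: "(\<Sum>v\<in>C. f v - m v) = 1 - U" and sg: "(\<Sum>v\<in>C. g v - m v) = 1 - U"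
    by (simp_all add: sum_subtractf f g U_def)
  have "0 \<le> (\<Sum>v\<in>C. f v - m v)" by (intro sum_nonneg) (simp add: m_def)
  then have U1: "U \<le> 1" using sf by simp
  have xeq: "x = (\<Sum>v\<in>C. (f v - m v) *\<^sub>R v) - (\<Sum>v\<in>C. (g v - m v) *\<^sub>R v)"
  proof -
    have "(\<Sum>v\<in>C. (f v - m v) *\<^sub>R v) - (\<Sum>v\<in>C. (g v - m v) *\<^sub>R v) = (\<Sum>v\<in>C. f v *\<^sub>R v) - (\<Sum>v\<in>C. g v *\<^sub>R v)"
      by (simp add: sum_subtractf[symmetric] algebra_simps)
    then show ?thesis using f g by simp
  qed
  have key: "\<exists>l. (\<forall>v\<in>C. 0 \<le> l v) \<and> sum l C = U \<and> y = (\<Sum>v\<in>C. l v *\<^sub>R v) + (\<Sum>v\<in>C. (f v - m v) *\<^sub>R v)"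
    if y: "y \<in> K" "y - x \<in> K" for y
  proof -
    obtain s where s: "\<And>v. v \<in> C \<Longrightarrow> 0 \<le> s v" "sum s C = 1" "(\<Sum>v\<in>C. s v *\<^sub>R v) = y"
      using y(1) unfolding hull by blast
    obtain t where t: "\<And>v. v \<in> C \<Longrightarrow> 0 \<le> t v" "sum t C = 1" "(\<Sum>v\<in>C. t v *\<^sub>R v) = y - x"
      using y(2) unfolding hull by blast
    have "(\<Sum>v\<in>C. (s v - t v - (f v - g v)) *\<^sub>R v)
        = (\<Sum>v\<in>C. s v *\<^sub>R v) - (\<Sum>v\<in>C. t v *\<^sub>R v) - ((\<Sum>v\<in>C. f v *\<^sub>R v) - (\<Sum>v\<in>C. g v *\<^sub>R v))"
      by (simp add: scaleR_diff_left sum_subtractf)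
    also have "\<dots> = 0" unfolding s(3) t(3) f(3) g(3) by simp
    finally have z1: "(\<Sum>v\<in>C. (s v - t v - (f v - g v)) *\<^sub>R v) = 0" .
    have z2: "(\<Sum>v\<in>C. s v - t v - (f v - g v)) = 0" by (simp add: sum_subtractf s t f g)
    have z: "s v - t v - (f v - g v) = 0" if "v \<in> C" for v
      using C(1) z1 z2 that unfolding affine_dependent_explicit_finite[OF fin] by blast
    have "(\<forall>v\<in>C. 0 \<le> s v - (f v - m v))"
    proof
      fix v assume v: "v \<in> C"
      show "0 \<le> s v - (f v - m v)" using z[OF v] s(1)[OF v] t(1)[OF v] by (simp add: m_def min_def)
    qed
    moreover have "(\<Sum>v\<in>C. s v - (f v - m v)) = U" using sf s(2) by (simp add: sum_subtractf)
    moreover have "y = (\<Sum>v\<in>C. (s v - (f v - m v)) *\<^sub>R v) + (\<Sum>v\<in>C. (f v - m v) *\<^sub>R v)"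
      using s(3) by (simp add: sum.distrib[symmetric] scaleR_add_left[symmetric])
    ultimately show ?thesis by (intro exI[of _ "\<lambda>v. s v - (f v - m v)"] conjI)
  qed
  have inhom: "{y \<in> K. y - x \<in> K} \<subseteq> (\<lambda>k. U *\<^sub>R k + (1 - U) *\<^sub>R a) ` K"
    if a: "(1 - U) *\<^sub>R a = (\<Sum>v\<in>C. (f v - m v) *\<^sub>R v)" "a \<in> K" for a
  proof clarify
    fix y assume "y \<in> K" "y - x \<in> K"
    then obtain l where l: "\<And>v. v \<in> C \<Longrightarrow> 0 \<le> l v" "sum l C = U"
      "y = (\<Sum>v\<in>C. l v *\<^sub>R v) + (1 - U) *\<^sub>R a" using key a(1) by metis
    show "y \<in> (\<lambda>k. U *\<^sub>R k + (1 - U) *\<^sub>R a) ` K"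
    proof (cases "U = 0")
      case True
      then have "l v = 0" if "v \<in> C" for v using l(1,2) fin that by (metis sum_nonneg_eq_0_iff)
      then have "y = (1 - U) *\<^sub>R a" using l(3) by simp
      then show ?thesis using True a(2) by (intro image_eqI[of _ _ a]) auto
    next
      case False
      then have "U > 0" using U0 by simp
      then have "(\<Sum>v\<in>C. (l v / U) *\<^sub>R v) \<in> K" using l by (intro inK) auto
      moreover have "(\<Sum>v\<in>C. l v *\<^sub>R v) = U *\<^sub>R (\<Sum>v\<in>C. (l v / U) *\<^sub>R v)"
        using False by (simp add: scaleR_sum_right)
      ultimately show ?thesis using l(3) by (intro image_eqI[of _ _ "\<Sum>v\<in>C. (l v / U) *\<^sub>R v"]) auto
    qed
  qed
  show ?thesis
  proof (cases "U = 1")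
    case True
    have "f v - m v = 0" if "v \<in> C" for v
      using sf True fin that sum_nonneg_eq_0_iff[of C "\<lambda>v. f v - m v"] by (auto simp: m_def)
    moreover have "g v - m v = 0" if "v \<in> C" for v
      using sg True fin that sum_nonneg_eq_0_iff[of C "\<lambda>v. g v - m v"] by (auto simp: m_def)
    ultimately have "x = 0" "(\<Sum>v\<in>C. (f v - m v) *\<^sub>R v) = 0" using xeq by simp_all
    then show ?thesis using that[OF U0 U1 p(1) p(1)] inhom[of p] True p by simp
  next
    case False
    then have pos: "1 - U > 0" using U1 by simp
    define a where "a = (\<Sum>v\<in>C. ((f v - m v) / (1 - U)) *\<^sub>R v)"
    define b where "b = (\<Sum>v\<in>C. ((g v - m v) / (1 - U)) *\<^sub>R v)"
    have ab: "a \<in> K" "b \<in> K" unfolding a_def b_def using sf sg pos by (intro inK; simp add: m_def)+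
    have ae: "(1 - U) *\<^sub>R a = (\<Sum>v\<in>C. (f v - m v) *\<^sub>R v)" and be: "(1 - U) *\<^sub>R b = (\<Sum>v\<in>C. (g v - m v) *\<^sub>R v)"
      unfolding a_def b_def using pos by (simp_all add: scaleR_sum_right)
    have "x = (1 - U) *\<^sub>R (a - b)" unfolding scaleR_diff_right ae be by (rule xeq)
    then show ?thesis using that[OF U0 U1 ab] inhom[OF ae ab(1)] by blast
  qed
qed

lemma simplex_interior_nonempty:
  fixes K :: "'a::euclidean_space set"
  assumes "int DIM('a) simplex K" shows "interior K \<noteq> {}"
proof -
  obtain C where C: "\<not> affine_dependent C" "int (card C) = int DIM('a) + 1" "K = convex hull C"
    using assms by (auto simp: simplex_def)
  show ?thesis using interior_convex_hull_eq_empty[of C] C by auto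
qed

lemma rogers_shephard_equality_of_simplex:
  fixes K :: "'a::euclidean_space set"
  assumes "int DIM('a) simplex K"
  shows "emeasure lborel (difference_body K)
           = of_nat ((2 * DIM('a)) choose DIM('a)) * emeasure lborel K"
proof -
  obtain C where C: "\<not> affine_dependent C" "int (card C) = int DIM('a) + 1" "K = convex hull C"
    using assms by (auto simp: simplex_def)
  have K: "convex K" "compact K"
    using C aff_independent_finite[OF C(1)] by (auto intro: finite_imp_compact_convex_hull)
  have "covariogram K x = overlap_profile K x * emeasure lborel K" for x
  proof (rule antisym)
    show "covariogram K x \<le> overlap_profile K x * emeasure lborel K"
    proof (cases "\<exists>p. p \<in> K \<and> p - x \<in> K")
      case True
      then obtain p where p: "p \<in> K" "p - x \<in> K" by blast
      obtain U a b where *: "0 \<le> U" "U \<le> 1" "a \<in> K" "b \<in> K" "x = (1 - U) *\<^sub>R (a - b)"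
        "{y \<in> K. y - x \<in> K} \<subseteq> (\<lambda>k. U *\<^sub>R k + (1 - U) *\<^sub>R a) ` K"
        by (rule simplex_overlap_subset_homothet[OF C(1,3) p])
      have "compact ((\<lambda>k. U *\<^sub>R k + (1 - U) *\<^sub>R a) ` K)"
        using K by (intro compact_continuous_image continuous_intros)
      then have "covariogram K x \<le> emeasure lborel ((\<lambda>k. U *\<^sub>R k + (1 - U) *\<^sub>R a) ` K)"
        unfolding covariogram_def using *(6) by (intro emeasure_mono) (auto simp: borel_compact)
      also have "\<dots> = ennreal (U ^ DIM('a)) * emeasure lborel K"
        using K * by (intro emeasure_homothet) auto
      also have "\<dots> \<le> overlap_profile K x * emeasure lborel K"
        using overlap_profile_ge[OF K(1) *(3,4,1,2)] *(5) by (intro mult_right_mono) auto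
      finally show ?thesis .
    next
      case False
      then have "{y \<in> K. y - x \<in> K} = {}" by blast
      then show ?thesis by (simp only: covariogram_def emeasure_empty)  simp
    qed
  qed (rule overlap_profile_le_covariogram[OF K])
  then show ?thesis
    using rogers_shephard_equality_iff_AE[OF K simplex_interior_nonempty[OF assms]] by simp
qed

section \<open>Means and sums of order alpha\<close>

lemma alpha_mean_ge_min:
  assumes "\<alpha> \<le> 0" "0 < a" "0 < b" "0 \<le> t" "t \<le> 1"
  shows "min a b \<le> alpha_mean \<alpha> t a b"
proof -
  define m where "m = min a b"
  have m: "0 < m" "m \<le> a" "m \<le> b" using assms by (auto simp: m_def)
  show ?thesis
  proof (cases "\<alpha> = 0")
    case True
    have "m = m powr t * m powr (1 - t)" using m by (simp add: powr_add[symmetric])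
    also have "\<dots> \<le> a powr t * b powr (1 - t)"
      using m assms by (intro mult_mono powr_mono2) auto
    finally show ?thesis using True by (simp add: alpha_mean_def m_def)
  next
    case False
    then have \<alpha>: "\<alpha> < 0" using assms by simp
    have "a powr \<alpha> \<le> m powr \<alpha>" "b powr \<alpha> \<le> m powr \<alpha>" using m \<alpha> by (auto intro!: powr_mono2')
    then have le: "t * a powr \<alpha> + (1 - t) * b powr \<alpha> \<le> m powr \<alpha>"
      using assms by (intro convex_bound_le) auto
    have "0 < t * a powr \<alpha> + (1 - t) * b powr \<alpha>"
    proof (cases "t = 0")
      case True then show ?thesis using assms by simp
    next
      case False
      then show ?thesis using assms by (intro add_pos_nonneg mult_pos_pos mult_nonneg_nonneg) auto
    qed
    then have "(m powr \<alpha>) powr (1 / \<alpha>) \<le> (t * a powr \<alpha> + (1 - t) * b powr \<alpha>) powr (1 / \<alpha>)"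
      using le \<alpha> by (intro powr_mono2') auto
    then show ?thesis using False m by (simp add: alpha_mean_def powr_powr m_def)
  qed
qed

text \<open>
  Midpoints towards a point of value 1 rise above the minimum \<open>m\<close> by an amount that depends on \<open>m\<close>
  only.
\<close>
lemma alpha_mean_half_gt:
  assumes "\<alpha> \<le> 0" "0 < m" "m < 1" "m \<le> a"
  shows "m < alpha_mean \<alpha> (1/2) m 1" and "alpha_mean \<alpha> (1/2) m 1 \<le> alpha_mean \<alpha> (1/2) a 1"
proof -
  show "m < alpha_mean \<alpha> (1/2) m 1"
  proof (cases "\<alpha> = 0")
    case True
    have "m = m powr (1/2) * m powr (1/2)" using assms by (simp add: powr_add[symmetric])
    also have "\<dots> < m powr (1/2) * 1"
      using assms powr_less_mono2[of "1/2" m 1] by (intro mult_strict_left_mono) auto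
    finally show ?thesis using True by (simp add: alpha_mean_def)
  next
    case False
    then have \<alpha>: "\<alpha> < 0" using assms by simp
    have "1 < m powr \<alpha>" using powr_less_mono2_neg[OF \<alpha>, of m 1] assms by simp
    then have "(m powr \<alpha>) powr (1 / \<alpha>) < (1/2 * m powr \<alpha> + 1/2) powr (1 / \<alpha>)"
      using \<alpha> by (intro powr_less_mono2_neg) (auto simp: add_pos_pos)
    then show ?thesis using False assms by (simp add: alpha_mean_def powr_powr)
  qed
  show "alpha_mean \<alpha> (1/2) m 1 \<le> alpha_mean \<alpha> (1/2) a 1"
  proof (cases "\<alpha> = 0")
    case True
    then show ?thesis using assms by (auto simp: alpha_mean_def intro: powr_mono2)
  next
    case False
    then have \<alpha>: "\<alpha> < 0" using assms by simp
    have "a powr \<alpha> \<le> m powr \<alpha>" using \<alpha> assms by (intro powr_mono2') auto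
    then have "(1/2 * m powr \<alpha> + 1/2) powr (1 / \<alpha>) \<le> (1/2 * a powr \<alpha> + 1/2) powr (1 / \<alpha>)"
      using \<alpha> by (intro powr_mono2') (auto intro: add_nonneg_pos)
    then show ?thesis using False by (simp add: alpha_mean_def)
  qed
qed

lemma alpha_term_commute: "alpha_term \<alpha> a b = alpha_term \<alpha> b a"
  by (auto simp: alpha_term_def add.commute)

lemma alpha_term_one:
  assumes "\<alpha> \<le> 0" "0 \<le> a" shows "alpha_term \<alpha> a 1 = a"
  using assms by (auto simp: alpha_term_def powr_powr)

lemma one_le_powr_nonpos: "1 \<le> b powr \<alpha>" if "\<alpha> \<le> 0" "0 < b" "b \<le> 1" for b \<alpha> :: real
  using powr_mono2'[OF that(1,2,3)] by simp

lemma alpha_term_mono: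
  assumes "\<alpha> \<le> 0" "0 < a" "a \<le> a'" "a' \<le> 1" "0 < b" "b \<le> b'" "b' \<le> 1"
  shows "alpha_term \<alpha> a b \<le> alpha_term \<alpha> a' b'"
proof (cases "\<alpha> = 0")
  case True
  then show ?thesis using assms by (auto simp: alpha_term_def intro: mult_mono)
next
  case False
  have "a' powr \<alpha> \<le> a powr \<alpha>" "b' powr \<alpha> \<le> b powr \<alpha>" "1 \<le> a' powr \<alpha>" "1 \<le> b' powr \<alpha>"
    using assms by (auto intro!: powr_mono2' one_le_powr_nonpos)
  then have "(a powr \<alpha> + b powr \<alpha> - 1) powr (1 / \<alpha>) \<le> (a' powr \<alpha> + b' powr \<alpha> - 1) powr (1 / \<alpha>)"
    using assms False by (intro powr_mono2') (auto simp: divide_le_0_iff)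
  then show ?thesis using False assms by (auto simp: alpha_term_def)
qed

lemma alpha_term_le_left:
  assumes "\<alpha> \<le> 0" "0 \<le> a" "a \<le> 1" "0 \<le> b" "b \<le> 1"
  shows "alpha_term \<alpha> a b \<le> a"
proof (cases "a = 0 \<or> b = 0")
  case True
  then show ?thesis using assms by (auto simp: alpha_term_def)
next
  case False
  then have "alpha_term \<alpha> a b \<le> alpha_term \<alpha> a 1" using assms by (intro alpha_term_mono) auto
  then show ?thesis using alpha_term_one assms by simp
qed

text \<open>
  Strictness is what makes equality rigid: if neither value is 1, the \<open>\<alpha>\<close>-term is below both.
\<close>
lemma alpha_term_less_left:
  assumes "\<alpha> \<le> 0" "0 < a" "a \<le> 1" "0 < b" "b < 1"
  shows "alpha_term \<alpha> a b < a"
proof (cases "\<alpha> = 0")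
  case True
  then show ?thesis using assms by (auto simp: alpha_term_def)
next
  case False
  then have \<alpha>: "\<alpha> < 0" using assms by simp
  have "1 < b powr \<alpha>" using powr_less_mono2_neg[OF \<alpha>, of b 1] assms by simp
  then have "(a powr \<alpha> + b powr \<alpha> - 1) powr (1 / \<alpha>) < (a powr \<alpha>) powr (1 / \<alpha>)"
    using \<alpha> assms by (intro powr_less_mono2_neg) auto
  then show ?thesis using False assms by (simp add: alpha_term_def powr_powr)
qed

lemma tendsto_alpha_term:
  assumes "\<alpha> \<le> 0" "A \<longlonglongrightarrow> a" "B \<longlonglongrightarrow> b" "0 < s"
    "\<And>n. s \<le> A n" "\<And>n. A n \<le> 1" "\<And>n. s \<le> B n" "\<And>n. B n \<le> 1"
  shows "(\<lambda>n. alpha_term \<alpha> (A n) (B n)) \<longlonglongrightarrow> alpha_term \<alpha> a b"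
proof (cases "\<alpha> = 0")
  case True
  then show ?thesis unfolding alpha_term_def using assms by (auto intro: tendsto_mult)
next
  case False
  have ab: "s \<le> a" "a \<le> 1" "s \<le> b" "b \<le> 1"
    using assms by (auto intro: LIMSEQ_le_const LIMSEQ_le_const2)
  have pos: "1 \<le> a powr \<alpha>" "1 \<le> b powr \<alpha>" using ab assms by (auto intro!: one_le_powr_nonpos)
  have "(\<lambda>n. (A n powr \<alpha> + B n powr \<alpha> - 1) powr (1 / \<alpha>)) \<longlonglongrightarrow> (a powr \<alpha> + b powr \<alpha> - 1) powr (1 / \<alpha>)"
    using assms(2,3,4) ab pos by (intro tendsto_powr tendsto_intros) auto
  moreover have "A n \<noteq> 0" "B n \<noteq> 0" for n using assms(4) assms(5)[of n] assms(7)[of n] by linarith+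
  moreover have "a \<noteq> 0" "b \<noteq> 0" using ab assms(4) by auto
  ultimately show ?thesis using False by (simp add: alpha_term_def)
qed

section \<open>Level sets of a function and of its difference function\<close>

definition superlevel :: "('a \<Rightarrow> real) \<Rightarrow> real \<Rightarrow> 'a set" where
  "superlevel f s = {x. s \<le> f x}"

text \<open>
  Up to strictness of the inequality, the superlevel set of the \<open>\<alpha>\<close>-sum of \<open>f\<close> with its reflection.
\<close>
definition difference_level :: "real \<Rightarrow> ('a::real_vector \<Rightarrow> real) \<Rightarrow> real \<Rightarrow> 'a set" where
  "difference_level \<alpha> f s = {y - z |y z. s \<le> alpha_term \<alpha> (f y) (f z)}"

lemma C_alphaD:
  fixes f :: "real ^ 'n \<Rightarrow> real"
  assumes "f \<in> C_alpha \<alpha>"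
  shows "0 \<le> f x" "f x \<le> 1" "f 0 = 1" "upper_semicontinuous f" "alpha_concave \<alpha> f"
    "(f \<longlongrightarrow> 0) at_infinity"
proof -
  have "ereal \<bar>f x\<bar> \<le> sup_norm f" unfolding sup_norm_def by (rule SUP_upper) simp
  then show "f x \<le> 1" using assms by (simp add: C_alpha_def one_ereal_def)
qed (use assms in \<open>auto simp: C_alpha_def\<close>)

lemma open_sublevel_of_upper_semicontinuous:
  assumes "upper_semicontinuous f" shows "open {x. f x < c}"
  using assms unfolding upper_semicontinuous_def open_subopen[of "{x. f x < c}"] eventually_nhds
  by fastforce

lemma borel_measurable_upper_semicontinuous:
  assumes "upper_semicontinuous f" shows "f \<in> borel_measurable borel"
  by (rule borel_measurableI_less) (use open_sublevel_of_upper_semicontinuous[OF assms] in auto)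

lemma compact_superlevel:
  fixes f :: "real ^ 'n \<Rightarrow> real"
  assumes f: "f \<in> C_alpha \<alpha>" and s: "0 < s"
  shows "compact (superlevel f s)"
proof -
  have "superlevel f s = - {x. f x < s}" by (auto simp: superlevel_def)
  then have "closed (superlevel f s)"
    using open_sublevel_of_upper_semicontinuous[OF C_alphaD(4)[OF f]] by (simp add: closed_Compl)
  moreover have "\<forall>\<^sub>F x in at_infinity. f x < s"
    using order_tendstoD(2)[OF C_alphaD(6)[OF f] s] .
  then obtain b where b: "\<And>x. b \<le> norm x \<Longrightarrow> f x < s" by (auto simp: eventually_at_infinity)
  have "norm x \<le> b" if "s \<le> f x" for x
    using b[of x] that by (cases "b \<le> norm x") auto
  then have "superlevel f s \<subseteq> cball 0 b" by (auto simp: superlevel_def)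
  then have "bounded (superlevel f s)" using bounded_cball bounded_subset by blast
  ultimately show ?thesis by (simp add: compact_eq_bounded_closed)
qed

lemma C_alpha_convex_combination_ge_min:
  fixes f :: "real ^ 'n \<Rightarrow> real"
  assumes f: "f \<in> C_alpha \<alpha>" and "\<alpha> \<le> 0" and t: "0 \<le> t" "t \<le> 1"
  shows "min (f x) (f y) \<le> f (t *\<^sub>R x + (1 - t) *\<^sub>R y)"
proof (cases "f x > 0 \<and> f y > 0")
  case True
  then have "min (f x) (f y) \<le> alpha_mean \<alpha> t (f x) (f y)" using assms by (intro alpha_mean_ge_min) auto
  also have "\<dots> \<le> f (t *\<^sub>R x + (1 - t) *\<^sub>R y)"
    using C_alphaD(5)[OF f] True t by (auto simp: alpha_concave_def)
  finally show ?thesis .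
next
  case False
  then have "min (f x) (f y) \<le> 0" by auto
  then show ?thesis using C_alphaD(1)[OF f] order_trans by blast
qed

lemma convex_superlevel:
  fixes f :: "real ^ 'n \<Rightarrow> real"
  assumes f: "f \<in> C_alpha \<alpha>" and "\<alpha> \<le> 0"
  shows "convex (superlevel f s)"
proof (rule convexI)
  fix x y :: "real ^ 'n" and u v :: real
  assume *: "x \<in> superlevel f s" "y \<in> superlevel f s" "0 \<le> u" "0 \<le> v" "u + v = 1"
  then have v: "v = 1 - u" "u \<le> 1" by simp_all
  have "min (f x) (f y) \<le> f (u *\<^sub>R x + v *\<^sub>R y)"
    unfolding v(1) by (rule C_alpha_convex_combination_ge_min[OF assms *(3) v(2)])
  then show "u *\<^sub>R x + v *\<^sub>R y \<in> superlevel f s" using * by (simp add: superlevel_def min_def split: if_splits)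
qed

lemma alpha_term_ge_imp_superlevel:
  fixes f :: "real ^ 'n \<Rightarrow> real"
  assumes f: "f \<in> C_alpha \<alpha>" and \<alpha>: "\<alpha> \<le> 0" and "s \<le> alpha_term \<alpha> (f y) (f z)"
  shows "y \<in> superlevel f s" "z \<in> superlevel f s"
proof -
  show "y \<in> superlevel f s"
    using alpha_term_le_left[OF \<alpha>, of "f y" "f z"] C_alphaD(1,2)[OF f] assms(3)
    by (auto simp: superlevel_def intro: order_trans)
  show "z \<in> superlevel f s"
    using alpha_term_le_left[OF \<alpha>, of "f z" "f y"] C_alphaD(1,2)[OF f] assms(3)
    by (auto simp: superlevel_def alpha_term_commute[of \<alpha> "f y" "f z"] intro: order_trans)
qed

lemma difference_level_subset:
  fixes f :: "real ^ 'n \<Rightarrow> real"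
  assumes "f \<in> C_alpha \<alpha>" "\<alpha> \<le> 0"
  shows "difference_level \<alpha> f s \<subseteq> difference_body (superlevel f s)"
  unfolding difference_level_def difference_body_def
  using alpha_term_ge_imp_superlevel[OF assms] by blast

lemma upper_semicontinuous_limit_ge:
  assumes "upper_semicontinuous f" "Y \<longlonglongrightarrow> y" "(\<lambda>n. f (Y n)) \<longlonglongrightarrow> a"
  shows "a \<le> f y"
proof (rule ccontr)
  assume "\<not> a \<le> f y"
  then obtain c where c: "f y < c" "c < a" using dense[of "f y" a] by auto
  then have "\<forall>\<^sub>F x in nhds y. f x < c" using assms(1) by (auto simp: upper_semicontinuous_def)
  then have "\<forall>\<^sub>F n in sequentially. f (Y n) < c"
    using assms(2) by (auto simp: filterlim_iff)
  then have "\<forall>\<^sub>F n in sequentially. f (Y n) \<le> c" by (rule eventually_mono) simp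
  then have "a \<le> c" using tendsto_upperbound[OF assms(3)] by simp
  then show False using c by simp
qed

text \<open>
  Pairs \<open>(y, z)\<close> that witness membership stay in the compact set \<open>L\<^sub>s \<times> L\<^sub>s\<close>. Passing to a limit,
  upper semicontinuity can only increase the values of \<open>f\<close>, and the \<open>\<alpha>\<close>-term is monotone and
  continuous away from 0.
\<close>
lemma closed_difference_level:
  fixes f :: "real ^ 'n \<Rightarrow> real"
  assumes f: "f \<in> C_alpha \<alpha>" and \<alpha>: "\<alpha> \<le> 0" and s: "0 < s"
  shows "closed (difference_level \<alpha> f s)"
  unfolding closed_sequential_limits
proof (intro allI impI, elim conjE)
  fix X :: "nat \<Rightarrow> real ^ 'n" and x
  assume X: "\<forall>n. X n \<in> difference_level \<alpha> f s" and lim: "X \<longlonglongrightarrow> x"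
  then have "\<forall>n. \<exists>q. X n = fst q - snd q \<and> s \<le> alpha_term \<alpha> (f (fst q)) (f (snd q))"
    unfolding difference_level_def by fastforce
  then obtain q where q: "\<And>n. X n = fst (q n) - snd (q n)"
      "\<And>n. s \<le> alpha_term \<alpha> (f (fst (q n))) (f (snd (q n)))"
    by metis
  define Y Z where "Y n = fst (q n)" and "Z n = snd (q n)" for n
  have YZ: "X n = Y n - Z n" "s \<le> alpha_term \<alpha> (f (Y n)) (f (Z n))" for n
    using q by (simp_all add: Y_def Z_def)
  have L: "Y n \<in> superlevel f s" "Z n \<in> superlevel f s" for n
    using alpha_term_ge_imp_superlevel[OF f \<alpha> YZ(2)] by blast+
  let ?L = "superlevel f s"
  have cmp: "compact (?L \<times> ?L \<times> {s..1} \<times> {s..1})"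
    using compact_superlevel[OF f s] by (intro compact_Times) auto
  have mem: "\<forall>n. (Y n, Z n, f (Y n), f (Z n)) \<in> ?L \<times> ?L \<times> {s..1} \<times> {s..1}"
    using L C_alphaD(2)[OF f] by (auto simp: superlevel_def)
  obtain p \<phi> where p: "p \<in> ?L \<times> ?L \<times> {s..1} \<times> {s..1}" "strict_mono \<phi>"
      "((\<lambda>n. (Y n, Z n, f (Y n), f (Z n))) \<circ> \<phi>) \<longlonglongrightarrow> p"
    by (rule seq_compactE[OF compact_imp_seq_compact[OF cmp] mem])
  obtain y z a b where pe: "p = (y, z, a, b)" by (rule prod_cases4)
  have lims: "(\<lambda>n. Y (\<phi> n)) \<longlonglongrightarrow> y" "(\<lambda>n. Z (\<phi> n)) \<longlonglongrightarrow> z"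
    "(\<lambda>n. f (Y (\<phi> n))) \<longlonglongrightarrow> a" "(\<lambda>n. f (Z (\<phi> n))) \<longlonglongrightarrow> b"
    using tendsto_fst[OF p(3)] tendsto_fst[OF tendsto_snd[OF p(3)]]
      tendsto_fst[OF tendsto_snd[OF tendsto_snd[OF p(3)]]]
      tendsto_snd[OF tendsto_snd[OF tendsto_snd[OF p(3)]]]
    by (simp_all add: pe o_def)
  have ab: "s \<le> a" "s \<le> b" using p(1) by (simp_all add: pe)
  have le: "a \<le> f y" "b \<le> f z"
    using upper_semicontinuous_limit_ge[OF C_alphaD(4)[OF f]] lims by blast+
  have "(\<lambda>n. alpha_term \<alpha> (f (Y (\<phi> n))) (f (Z (\<phi> n)))) \<longlonglongrightarrow> alpha_term \<alpha> a b"
    using L C_alphaD(2)[OF f] by (intro tendsto_alpha_term[OF \<alpha> lims(3,4) s]) (auto simp: superlevel_def)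
  then have "s \<le> alpha_term \<alpha> a b" by (rule LIMSEQ_le_const) (use YZ(2) in blast)
  also have "\<dots> \<le> alpha_term \<alpha> (f y) (f z)"
    using ab le s C_alphaD(2)[OF f] by (intro alpha_term_mono[OF \<alpha>]) auto
  finally have "y - z \<in> difference_level \<alpha> f s" by (auto simp: difference_level_def)
  moreover have "x = y - z"
  proof -
    have "(\<lambda>n. X (\<phi> n)) \<longlonglongrightarrow> x" using LIMSEQ_subseq_LIMSEQ[OF lim p(2)] by (simp add: o_def)
    moreover have "(\<lambda>n. X (\<phi> n)) \<longlonglongrightarrow> y - z" unfolding YZ(1) by (intro tendsto_diff lims)
    ultimately show ?thesis by (rule LIMSEQ_unique)
  qed
  ultimately show "x \<in> difference_level \<alpha> f s" by simp
qed

text \<open>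
  The strict and the weak superlevel sets of the \<open>\<alpha>\<close>-sum enclose the closed sets
  \<open>difference_level\<close>. Since the layer-cake formula holds for either kind, the attainment of the
  supremum never has to be discussed.
\<close>
lemma alpha_sum_reflect_bounds:
  fixes f :: "real ^ 'n \<Rightarrow> real"
  assumes f: "f \<in> C_alpha \<alpha>" and \<alpha>: "\<alpha> \<le> 0"
  shows "{x. s < alpha_sum \<alpha> f (reflect f) x} \<subseteq> difference_level \<alpha> f s"
    and "difference_level \<alpha> f s \<subseteq> {x. s \<le> alpha_sum \<alpha> f (reflect f) x}"
    and "0 \<le> alpha_sum \<alpha> f (reflect f) x" and "alpha_sum \<alpha> f (reflect f) x \<le> 1"
proof -
  let ?S = "\<lambda>x. {alpha_term \<alpha> (f y) (reflect f z) | y z. y + z = x}"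
  have ne: "alpha_term \<alpha> (f x) (reflect f 0) \<in> ?S x" for x by force
  have "alpha_term \<alpha> (f y) (f z) \<le> 1" for y z
    using alpha_term_le_left[OF \<alpha>, of "f y" "f z"] C_alphaD(1,2)[OF f] order_trans by blast
  then have le1: "w \<le> 1" if "w \<in> ?S x" for w x
    using that by (auto simp: reflect_def)
  then have bdd: "bdd_above (?S x)" for x by (intro bdd_aboveI) blast
  show "{x. s < alpha_sum \<alpha> f (reflect f) x} \<subseteq> difference_level \<alpha> f s"
  proof clarify
    fix x assume "s < alpha_sum \<alpha> f (reflect f) x"
    then have "\<exists>w\<in>?S x. s < w"
      unfolding alpha_sum_def using less_cSup_iff[OF _ bdd[of x]] ne[of x] by blast
    then obtain y z where yz: "y + z = x" "s < alpha_term \<alpha> (f y) (reflect f z)" by blast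
    then have "x = y - (- z)" "s \<le> alpha_term \<alpha> (f y) (f (- z))" by (auto simp: reflect_def)
    then show "x \<in> difference_level \<alpha> f s" unfolding difference_level_def by blast
  qed
  show "difference_level \<alpha> f s \<subseteq> {x. s \<le> alpha_sum \<alpha> f (reflect f) x}"
  proof (clarsimp simp: difference_level_def)
    fix y z assume s: "s \<le> alpha_term \<alpha> (f y) (f z)"
    have "alpha_term \<alpha> (f y) (f z) = alpha_term \<alpha> (f y) (reflect f (- z))" by (simp add: reflect_def)
    moreover have "y + - z = y - z" by simp
    ultimately have "alpha_term \<alpha> (f y) (f z) \<in> ?S (y - z)" by blast
    then have "alpha_term \<alpha> (f y) (f z) \<le> alpha_sum \<alpha> f (reflect f) (y - z)"
      unfolding alpha_sum_def by (rule cSup_upper[OF _ bdd])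
    then show "s \<le> alpha_sum \<alpha> f (reflect f) (y - z)" using s by simp
  qed
  have "alpha_term \<alpha> (f x) (reflect f 0) \<le> alpha_sum \<alpha> f (reflect f) x"
    unfolding alpha_sum_def by (rule cSup_upper[OF ne bdd])
  moreover have "alpha_term \<alpha> (f x) (reflect f 0) = f x"
    using alpha_term_one[OF \<alpha> C_alphaD(1)[OF f]] C_alphaD(3)[OF f] by (simp add: reflect_def)
  ultimately show "0 \<le> alpha_sum \<alpha> f (reflect f) x" using C_alphaD(1)[OF f, of x] by simp
  show "alpha_sum \<alpha> f (reflect f) x \<le> 1"
    unfolding alpha_sum_def using le1 ne by (intro cSup_least) blast+
qed

lemma borel_measurable_alpha_sum_reflect:
  fixes f :: "real ^ 'n \<Rightarrow> real"
  assumes f: "f \<in> C_alpha \<alpha>" and \<alpha>: "\<alpha> \<le> 0"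
  shows "alpha_sum \<alpha> f (reflect f) \<in> borel_measurable borel"
proof (rule borel_measurableI_greater)
  fix c :: real
  let ?g = "alpha_sum \<alpha> f (reflect f)"
  show "{x \<in> space borel. c < ?g x} \<in> sets borel"
  proof (cases "c < 0")
    case True
    then have "{x \<in> space borel. c < ?g x} = UNIV"
      using alpha_sum_reflect_bounds(3)[OF assms] by (auto intro: less_le_trans)
    then show ?thesis by simp
  next
    case False
    have "{x \<in> space borel. c < ?g x} = (\<Union>r\<in>{r\<in>\<rat>. c < r}. difference_level \<alpha> f r)"
    proof (intro set_eqI iffI)
      fix x assume "x \<in> {x \<in> space borel. c < ?g x}"
      then obtain r where "r \<in> \<rat>" "c < r" "r < ?g x" using Rats_dense_in_real[of c "?g x"] by auto
      then show "x \<in> (\<Union>r\<in>{r\<in>\<rat>. c < r}. difference_level \<alpha> f r)"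
        using alpha_sum_reflect_bounds(1)[OF assms, of r] by blast
    next
      fix x assume "x \<in> (\<Union>r\<in>{r\<in>\<rat>. c < r}. difference_level \<alpha> f r)"
      then obtain r where "c < r" "x \<in> difference_level \<alpha> f r" by blast
      then have "c < r" "r \<le> ?g x" using alpha_sum_reflect_bounds(2)[OF assms, of r] by blast+
      then show "x \<in> {x \<in> space borel. c < ?g x}" by simp
    qed
    also have "\<dots> \<in> sets borel"
    proof (rule sets.countable_UN'')
      have "{r \<in> \<rat>. c < r} \<subseteq> \<rat>" by blast
      then show "countable {r \<in> \<rat>. c < r}" using countable_rat countable_subset by blast
      fix r assume "r \<in> {r \<in> \<rat>. c < r}"
      then show "difference_level \<alpha> f r \<in> sets borel"
        using closed_difference_level[OF assms, of r] False by auto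
    qed
    finally show ?thesis .
  qed
qed

text \<open>
  Fubini's theorem for the region below the graph: its fibre over \<open>x\<close> is an interval of length
  \<open>g x\<close>, with or without its right end.
\<close>
lemma layer_cake:
  fixes g :: "'a::euclidean_space \<Rightarrow> real"
  assumes [measurable]: "g \<in> borel_measurable borel" and g: "\<And>x. 0 \<le> g x" "\<And>x. g x \<le> 1"
  shows "(\<integral>\<^sup>+x. ennreal (g x) \<partial>lborel) = (\<integral>\<^sup>+s. indicator {0<..1} s * emeasure lborel {x. s \<le> g x} \<partial>lborel)"
    and "(\<integral>\<^sup>+x. ennreal (g x) \<partial>lborel) = (\<integral>\<^sup>+s. indicator {0<..1} s * emeasure lborel {x. s < g x} \<partial>lborel)"
    and "(\<lambda>s. emeasure lborel {x. s \<le> g x}) \<in> borel_measurable borel"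
    and "(\<lambda>s. emeasure lborel {x. s < g x}) \<in> borel_measurable borel"
proof -
  have [measurable]: "g \<in> borel_measurable lborel" by simp
  have meas: "(\<lambda>(x, s). indicator {0<..1} s * indicator {x. s \<le> g x} x :: ennreal) \<in> borel_measurable (lborel \<Otimes>\<^sub>M lborel)"
    "(\<lambda>(x, s). indicator {0<..1} s * indicator {x. s < g x} x :: ennreal) \<in> borel_measurable (lborel \<Otimes>\<^sub>M lborel)"
    unfolding indicator_def mem_Collect_eq by measurable
  have "(\<integral>\<^sup>+s. indicator {0<..1} s * indicator {x. s \<le> g x} x \<partial>lborel) = ennreal (g x)" for x
  proof -
    have "(\<integral>\<^sup>+s. indicator {0<..1} s * indicator {x. s \<le> g x} x \<partial>lborel)
       = (\<integral>\<^sup>+s. indicator {0<..g x} s \<partial>lborel)"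
      using g[of x] by (intro nn_integral_cong) (auto simp: indicator_def)
    then show ?thesis using g[of x] by simp
  qed
  then have "(\<integral>\<^sup>+x. ennreal (g x) \<partial>lborel)
      = (\<integral>\<^sup>+x. (\<integral>\<^sup>+s. indicator {0<..1} s * indicator {x. s \<le> g x} x \<partial>lborel) \<partial>lborel)" by simp
  also have "\<dots> = (\<integral>\<^sup>+s. (\<integral>\<^sup>+x. indicator {0<..1} s * indicator {x. s \<le> g x} x \<partial>lborel) \<partial>lborel)"
    by (rule lborel_pair.Fubini'[OF meas(1), symmetric])
  also have "\<dots> = (\<integral>\<^sup>+s. indicator {0<..1} s * emeasure lborel {x. s \<le> g x} \<partial>lborel)"
    by (intro nn_integral_cong) (simp add: nn_integral_cmult)
  finally show "(\<integral>\<^sup>+x. ennreal (g x) \<partial>lborel) = (\<integral>\<^sup>+s. indicator {0<..1} s * emeasure lborel {x. s \<le> g x} \<partial>lborel)" .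
  have "(\<integral>\<^sup>+s. indicator {0<..1} s * indicator {x. s < g x} x \<partial>lborel) = ennreal (g x)" for x
  proof -
    have "(\<integral>\<^sup>+s. indicator {0<..1} s * indicator {x. s < g x} x \<partial>lborel)
       = (\<integral>\<^sup>+s. indicator {0<..<g x} s \<partial>lborel)"
      using g[of x] by (intro nn_integral_cong) (auto simp: indicator_def)
    then show ?thesis using g[of x] by simp
  qed
  then have "(\<integral>\<^sup>+x. ennreal (g x) \<partial>lborel)
      = (\<integral>\<^sup>+x. (\<integral>\<^sup>+s. indicator {0<..1} s * indicator {x. s < g x} x \<partial>lborel) \<partial>lborel)" by simp
  also have "\<dots> = (\<integral>\<^sup>+s. (\<integral>\<^sup>+x. indicator {0<..1} s * indicator {x. s < g x} x \<partial>lborel) \<partial>lborel)"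
    by (rule lborel_pair.Fubini'[OF meas(2), symmetric])
  also have "\<dots> = (\<integral>\<^sup>+s. indicator {0<..1} s * emeasure lborel {x. s < g x} \<partial>lborel)"
    by (intro nn_integral_cong) (simp add: nn_integral_cmult)
  finally show "(\<integral>\<^sup>+x. ennreal (g x) \<partial>lborel) = (\<integral>\<^sup>+s. indicator {0<..1} s * emeasure lborel {x. s < g x} \<partial>lborel)" .
  have "{p \<in> space (lborel \<Otimes>\<^sub>M lborel). fst p \<le> g (snd p)} \<in> sets (lborel \<Otimes>\<^sub>M lborel)"
    by measurable
  then have "(\<lambda>s. emeasure lborel {x. s \<le> g x}) \<in> borel_measurable lborel"
    by (intro lborel.measurable_emeasure) simp_all
  then show "(\<lambda>s. emeasure lborel {x. s \<le> g x}) \<in> borel_measurable borel" by simp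
  have "{p \<in> space (lborel \<Otimes>\<^sub>M lborel). fst p < g (snd p)} \<in> sets (lborel \<Otimes>\<^sub>M lborel)"
    by measurable
  then have "(\<lambda>s. emeasure lborel {x. s < g x}) \<in> borel_measurable lborel"
    by (intro lborel.measurable_emeasure) simp_all
  then show "(\<lambda>s. emeasure lborel {x. s < g x}) \<in> borel_measurable borel" by simp
qed

section \<open>The functional inequality by integration over levels\<close>

lemma emeasure_difference_level_le:
  fixes f :: "real ^ 'n \<Rightarrow> real"
  assumes f: "f \<in> C_alpha \<alpha>" and \<alpha>: "\<alpha> \<le> 0" and s: "0 < s"
  shows "emeasure lborel (difference_level \<alpha> f s) \<le> emeasure lborel (difference_body (superlevel f s))"
    and "emeasure lborel (difference_body (superlevel f s))
      \<le> of_nat ((2 * CARD('n)) choose CARD('n)) * emeasure lborel (superlevel f s)"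
proof -
  show "emeasure lborel (difference_level \<alpha> f s) \<le> emeasure lborel (difference_body (superlevel f s))"
    using compact_difference_body[OF compact_superlevel[OF f s]]
    by (intro emeasure_mono difference_level_subset[OF f \<alpha>]) (auto simp: borel_compact)
  show "emeasure lborel (difference_body (superlevel f s))
      \<le> of_nat ((2 * CARD('n)) choose CARD('n)) * emeasure lborel (superlevel f s)"
    using rogers_shephard[OF convex_superlevel[OF f \<alpha>] compact_superlevel[OF f s]] by simp
qed

text \<open>
  At each level the integrands are ordered by the Rogers--Shephard inequality for the superlevel
  set, once the level of the \<open>\<alpha>\<close>-sum is enlarged to the difference body of that set.
\<close>
lemma L1_norm_level_bounds:
  fixes f :: "real ^ 'n \<Rightarrow> real"
  assumes f: "f \<in> C_alpha \<alpha>" and \<alpha>: "\<alpha> \<le> 0"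
  defines "c \<equiv> of_nat ((2 * CARD('n)) choose CARD('n)) :: ennreal"
  defines "u \<equiv> \<lambda>s. indicator {0<..1} s * emeasure lborel {x. s < alpha_sum \<alpha> f (reflect f) x}"
    and "v \<equiv> \<lambda>s. c * (indicator {0<..1} s * emeasure lborel (superlevel f s))"
  shows "L1_norm (alpha_sum \<alpha> f (reflect f)) = (\<integral>\<^sup>+s. u s \<partial>lborel)"
    and "c * L1_norm f = (\<integral>\<^sup>+s. v s \<partial>lborel)"
    and "u s \<le> v s" and "u \<in> borel_measurable borel" and "v \<in> borel_measurable borel"
proof -
  note g = borel_measurable_alpha_sum_reflect[OF f \<alpha>] alpha_sum_reflect_bounds(3,4)[OF f \<alpha>]
  note h = borel_measurable_upper_semicontinuous[OF C_alphaD(4)[OF f]] C_alphaD(1,2)[OF f]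
  have mv: "(\<lambda>s. indicator {0<..1} s * emeasure lborel (superlevel f s)) \<in> borel_measurable borel"
    unfolding superlevel_def using layer_cake(3)[OF h] by measurable
  show "L1_norm (alpha_sum \<alpha> f (reflect f)) = (\<integral>\<^sup>+s. u s \<partial>lborel)"
    unfolding L1_norm_def u_def by (rule layer_cake(2)[OF g])
  have "L1_norm f = (\<integral>\<^sup>+s. indicator {0<..1} s * emeasure lborel (superlevel f s) \<partial>lborel)"
    unfolding L1_norm_def superlevel_def by (rule layer_cake(1)[OF h])
  then show "c * L1_norm f = (\<integral>\<^sup>+s. v s \<partial>lborel)"
    unfolding v_def using mv by (simp add: nn_integral_cmult)
  show "u \<in> borel_measurable borel"
    unfolding u_def using layer_cake(4)[OF g] by measurable
  show "v \<in> borel_measurable borel"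
    unfolding v_def using mv by measurable
  show "u s \<le> v s"
  proof (cases "0 < s \<and> s \<le> 1")
    case True
    have "emeasure lborel {x. s < alpha_sum \<alpha> f (reflect f) x} \<le> emeasure lborel (difference_level \<alpha> f s)"
      using closed_difference_level[OF f \<alpha>, of s] True
      by (intro emeasure_mono alpha_sum_reflect_bounds(1)[OF f \<alpha>]) auto
    also have "\<dots> \<le> c * emeasure lborel (superlevel f s)"
      using emeasure_difference_level_le[OF f \<alpha>, of s] True by (auto simp: c_def intro: order_trans)
    finally show ?thesis using True by (simp add: u_def v_def)
  qed (auto simp: u_def v_def)
qed

lemma L1_norm_alpha_sum_reflect_le:
  fixes f :: "real ^ 'n \<Rightarrow> real"
  assumes f: "f \<in> C_alpha \<alpha>" and \<alpha>: "\<alpha> \<le> 0"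
  shows "L1_norm (alpha_sum \<alpha> f (reflect f)) \<le> of_nat ((2 * CARD('n)) choose CARD('n)) * L1_norm f"
  unfolding L1_norm_level_bounds(1,2)[OF f \<alpha>]
  by (intro nn_integral_mono L1_norm_level_bounds(3)[OF f \<alpha>])

text \<open>
  Two ordered integrands with equal finite integrals agree almost everywhere. At such a level all
  inclusions \<open>{f \<star> f' > s} \<subseteq> W\<^sub>s \<subseteq> L\<^sub>s - L\<^sub>s\<close> preserve volume, where \<open>f'\<close> is the reflection of \<open>f\<close>, and
  the Rogers--Shephard inequality for \<open>L\<^sub>s\<close> is an equality.
\<close>
lemma equality_imp_AE_level:
  fixes f :: "real ^ 'n \<Rightarrow> real"
  assumes f: "f \<in> C_alpha \<alpha>" and \<alpha>: "\<alpha> \<le> 0" and int: "integrable lborel f"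
    and eq: "L1_norm (alpha_sum \<alpha> f (reflect f)) = of_nat ((2 * CARD('n)) choose CARD('n)) * L1_norm f"
  shows "AE s in lborel. 0 < s \<and> s \<le> 1 \<and> interior (superlevel f s) \<noteq> {} \<longrightarrow>
    difference_level \<alpha> f s = difference_body (superlevel f s) \<and> int CARD('n) simplex superlevel f s"
proof -
  let ?c = "of_nat ((2 * CARD('n)) choose CARD('n)) :: ennreal"
  note lb = L1_norm_level_bounds[OF f \<alpha>]
  have "L1_norm f < \<infinity>"
    using int C_alphaD(1)[OF f] unfolding integrable_iff_bounded L1_norm_def by simp
  then have "?c * L1_norm f < \<infinity>" by (simp add: ennreal_mult_less_top of_nat_less_top)
  then have "AE s in lborel. indicator {0<..1} s * emeasure lborel {x. s < alpha_sum \<alpha> f (reflect f) x}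
      = ?c * (indicator {0<..1} s * emeasure lborel (superlevel f s))"
    using eq lb by (intro AE_eq_of_nn_integral_eq) auto
  then show ?thesis
  proof (rule AE_mp, intro AE_I2 impI, elim conjE)
    fix s :: real
    assume s: "indicator {0<..1} s * emeasure lborel {x. s < alpha_sum \<alpha> f (reflect f) x}
      = ?c * (indicator {0<..1} s * emeasure lborel (superlevel f s))"
      "0 < s" "s \<le> 1" "interior (superlevel f s) \<noteq> {}"
    let ?K = "superlevel f s"
    have K: "convex ?K" "compact ?K" using convex_superlevel[OF f \<alpha>] compact_superlevel[OF f s(2)] by auto
    have "?c * emeasure lborel ?K = emeasure lborel {x. s < alpha_sum \<alpha> f (reflect f) x}"
      using s(1,2,3) by simp
    also have "\<dots> \<le> emeasure lborel (difference_level \<alpha> f s)"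
      using closed_difference_level[OF f \<alpha> s(2)]
      by (intro emeasure_mono alpha_sum_reflect_bounds(1)[OF f \<alpha>]) auto
    finally have ge: "?c * emeasure lborel ?K \<le> emeasure lborel (difference_level \<alpha> f s)" .
    note le = emeasure_difference_level_le[OF f \<alpha> s(2)]
    have "emeasure lborel (difference_body ?K) = ?c * emeasure lborel ?K"
      using ge le by (intro antisym) auto
    then have splx: "int CARD('n) simplex ?K"
      using simplex_of_rogers_shephard_equality[OF K s(4)] by simp
    have cD: "compact (difference_body ?K)" by (rule compact_difference_body[OF K(2)])
    have "difference_body ?K = difference_level \<alpha> f s"
    proof (rule convex_eq_closed_subset_same_measure)
      show "convex (difference_body ?K)" by (rule convex_difference_body[OF K(1)])
      show "closed (difference_body ?K)" by (rule compact_imp_closed[OF cD])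
      show "interior (difference_body ?K) \<noteq> {}" by (rule interior_difference_body_nonempty[OF s(4)])
      show "closed (difference_level \<alpha> f s)" by (rule closed_difference_level[OF f \<alpha> s(2)])
      show "difference_level \<alpha> f s \<subseteq> difference_body ?K" by (rule difference_level_subset[OF f \<alpha>])
      show "emeasure lborel (difference_body ?K) \<le> emeasure lborel (difference_level \<alpha> f s)"
        using ge le order_trans by blast
      show "emeasure lborel (difference_body ?K) < \<infinity>" by (rule emeasure_compact_finite[OF cD])
    qed
    then show "difference_level \<alpha> f s = difference_body ?K \<and> int CARD('n) simplex ?K" using splx by simp
  qed
qed

lemma equality_of_all_levels:
  fixes f :: "real ^ 'n \<Rightarrow> real"
  assumes f: "f \<in> C_alpha \<alpha>" and \<alpha>: "\<alpha> \<le> 0"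
    and lev: "\<And>s. 0 < s \<Longrightarrow> s \<le> 1 \<Longrightarrow> emeasure lborel (difference_level \<alpha> f s)
        = of_nat ((2 * CARD('n)) choose CARD('n)) * emeasure lborel (superlevel f s)"
  shows "L1_norm (alpha_sum \<alpha> f (reflect f)) = of_nat ((2 * CARD('n)) choose CARD('n)) * L1_norm f"
proof (rule antisym[OF L1_norm_alpha_sum_reflect_le[OF f \<alpha>]])
  let ?g = "alpha_sum \<alpha> f (reflect f)"
  note g = borel_measurable_alpha_sum_reflect[OF f \<alpha>] alpha_sum_reflect_bounds(3,4)[OF f \<alpha>]
  have "of_nat ((2 * CARD('n)) choose CARD('n)) * L1_norm f
      \<le> (\<integral>\<^sup>+s. indicator {0<..1} s * emeasure lborel {x. s \<le> ?g x} \<partial>lborel)"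
    unfolding L1_norm_level_bounds(2)[OF f \<alpha>]
  proof (rule nn_integral_mono)
    fix s :: real
    have "emeasure lborel (difference_level \<alpha> f s) \<le> emeasure lborel {x. s \<le> ?g x}"
      using g(1) by (intro emeasure_mono alpha_sum_reflect_bounds(2)[OF f \<alpha>]) measurable
    then show "of_nat (2 * CARD('n) choose CARD('n)) * (indicator {0<..1} s * emeasure lborel (superlevel f s))
         \<le> indicator {0<..1} s * emeasure lborel {x. s \<le> ?g x}"
      using lev[of s] by (cases "0 < s \<and> s \<le> 1") auto
  qed
  also have "\<dots> = L1_norm ?g" unfolding L1_norm_def by (rule layer_cake(1)[OF g, symmetric])
  finally show "of_nat ((2 * CARD('n)) choose CARD('n)) * L1_norm f \<le> L1_norm ?g" .
qed

section \<open>Rigidity of equality in dimension at least two\<close>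

text \<open>
  The support is the union of countably many superlevel sets, which are convex; were all of them
  without interior, they would be null, and so would be the support.
\<close>
lemma superlevel_interior_nonempty:
  fixes f :: "real ^ 'n \<Rightarrow> real"
  assumes f: "f \<in> C_alpha \<alpha>" and \<alpha>: "\<alpha> \<le> 0" and full: "interior (support f) \<noteq> {}"
  obtains s0 where "0 < s0" "\<And>s. s \<le> s0 \<Longrightarrow> interior (superlevel f s) \<noteq> {}"
proof -
  have "\<exists>k. interior (superlevel f (1 / real (Suc k))) \<noteq> {}"
  proof (rule ccontr)
    assume "\<not> ?thesis"
    then have "negligible (superlevel f (1 / real (Suc k)))" for k
      using negligible_convex_interior[OF convex_superlevel[OF f \<alpha>]] by blast
    then have "negligible (\<Union>k. superlevel f (1 / real (Suc k)))" by (rule negligible_Union_nat)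
    moreover have "support f \<subseteq> (\<Union>k. superlevel f (1 / real (Suc k)))"
    proof
      fix x assume "x \<in> support f"
      then obtain k where "1 / real (Suc k) < f x" using nat_approx_posE by (auto simp: support_def)
      then show "x \<in> (\<Union>k. superlevel f (1 / real (Suc k)))"
        by (auto simp: superlevel_def intro!: exI[of _ k] less_imp_le)
    qed
    ultimately have "negligible (interior (support f))"
      using interior_subset negligible_subset by blast
    then show False using open_not_negligible[OF open_interior full] by blast
  qed
  then obtain k where k: "interior (superlevel f (1 / real (Suc k))) \<noteq> {}" by blast
  show ?thesis
  proof (rule that[of "1 / real (Suc k)"])
    fix s assume "s \<le> 1 / real (Suc k)"
    then have "superlevel f (1 / real (Suc k)) \<subseteq> superlevel f s" by (auto simp: superlevel_def)
    then show "interior (superlevel f s) \<noteq> {}" using k interior_mono by blast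
  qed simp
qed

text \<open>
  Comparing barycentric coordinates, the coordinate of \<open>a\<close> at \<open>v\<close> exceeds that of \<open>b\<close> by 1, so it is 1.
\<close>
lemma vertex_difference_unique:
  fixes C :: "'a::euclidean_space set"
  assumes ind: "\<not> affine_dependent C" and vw: "v \<in> C" "w \<in> C" "v \<noteq> w"
    and ab: "a \<in> convex hull C" "b \<in> convex hull C" "a - b = v - w"
  shows "a = v \<and> b = w"
proof -
  have fin: "finite C" by (rule aff_independent_finite[OF ind])
  obtain f where f: "\<And>x. x \<in> C \<Longrightarrow> 0 \<le> f x" "sum f C = 1" "(\<Sum>x\<in>C. f x *\<^sub>R x) = a"
    using ab(1) convex_hull_finite[OF fin] by auto
  obtain g where g: "\<And>x. x \<in> C \<Longrightarrow> 0 \<le> g x" "sum g C = 1" "(\<Sum>x\<in>C. g x *\<^sub>R x) = b"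
    using ab(2) convex_hull_finite[OF fin] by auto
  \<comment> \<open>The coordinates of v - w.\<close>
  define d where "d x = (if x = v then 1 else 0) - (if x = w then 1 else (0::real))" for x
  have d: "sum d C = 0" "(\<Sum>x\<in>C. d x *\<^sub>R x) = v - w"
    using fin vw by (simp_all add: d_def sum_subtractf scaleR_diff_left if_distrib[of "\<lambda>c. c *\<^sub>R _"] cong: if_cong)
  have z1: "(\<Sum>x\<in>C. f x - g x - d x) = 0" using f(2) g(2) d(1) by (simp add: sum_subtractf)
  have z2: "(\<Sum>x\<in>C. (f x - g x - d x) *\<^sub>R x) = 0"
    using f(3) g(3) d(2) ab(3) by (simp add: sum_subtractf scaleR_diff_left)
  have z: "f x - g x - d x = 0" if "x \<in> C" for x
    using ind z1 z2 that unfolding affine_dependent_explicit_finite[OF fin] by blast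
  have "1 \<le> f v" using z[OF vw(1)] g(1)[OF vw(1)] vw(3) by (simp add: d_def)
  moreover have rest: "f v + sum f (C - {v}) = 1" using f(2) fin vw(1) by (simp add: sum.remove)
  moreover have "0 \<le> sum f (C - {v})" using f(1) by (intro sum_nonneg) auto
  ultimately have fv: "f v = 1" "sum f (C - {v}) = 0" by linarith+
  then have "f x = 0" if "x \<in> C - {v}" for x
    using that f(1) fin sum_nonneg_eq_0_iff[of "C - {v}" f] by auto
  then have "(\<Sum>x\<in>C - {v}. f x *\<^sub>R x) = 0" by (intro sum.neutral) simp
  moreover have "a = f v *\<^sub>R v + (\<Sum>x\<in>C - {v}. f x *\<^sub>R x)" using f(3) fin vw(1) by (simp add: sum.remove)
  ultimately have "a = v" using fv(1) by simp
  then show ?thesis using ab(3) by simp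
qed

text \<open>
  Let \<open>m = f v\<close> be the minimum of \<open>f\<close> on the simplex \<open>L\<^sub>s\<close>. All levels between \<open>s\<close> and \<open>m\<close> coincide
  with \<open>L\<^sub>s\<close>, so unique representation of \<open>v - w\<close>, applied at admissible levels close to \<open>m\<close>, gives
  the \<open>\<alpha>\<close>-term of \<open>f v\<close> and \<open>f w\<close> the lower bound \<open>m\<close>. By \<open>alpha_term_less_left\<close> this needs
  \<open>f w = 1\<close>. The predicate \<open>P\<close> stands for further information about almost every level.
\<close>
lemma equality_vertex_values:
  fixes f :: "real ^ 'n \<Rightarrow> real"
  assumes f: "f \<in> C_alpha \<alpha>" and \<alpha>: "\<alpha> \<le> 0"
    and AE: "AE s in lborel. 0 < s \<and> s \<le> 1 \<and> interior (superlevel f s) \<noteq> {} \<longrightarrow>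
      difference_level \<alpha> f s = difference_body (superlevel f s) \<and> P s"
    and s: "0 < s" "interior (superlevel f s) \<noteq> {}"
    and lev: "difference_level \<alpha> f s = difference_body (superlevel f s)"
    and C: "\<not> affine_dependent C" "superlevel f s = convex hull C"
    and v: "v \<in> C" "\<And>u. u \<in> C \<Longrightarrow> f v \<le> f u" "f v < 1" and w: "w \<in> C" "w \<noteq> v"
  shows "f w = 1" "superlevel f (f v) = superlevel f s"
proof -
  have Cs: "C \<subseteq> superlevel f s" using C(2) hull_subset by metis
  have "C \<subseteq> superlevel f (f v)" using v(2) by (auto simp: superlevel_def)
  then have "superlevel f s \<subseteq> superlevel f (f v)"
    unfolding C(2) by (intro hull_minimal convex_superlevel[OF f \<alpha>])
  moreover have sm: "s \<le> f v" using Cs v(1) by (auto simp: superlevel_def)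
  then have mono: "superlevel f (f v) \<subseteq> superlevel f s" by (auto simp: superlevel_def)
  ultimately show same: "superlevel f (f v) = superlevel f s" by blast
  have term_ge: "r \<le> alpha_term \<alpha> (f v) (f w)"
    if r: "superlevel f r = superlevel f s" "difference_level \<alpha> f r = difference_body (superlevel f r)" for r
  proof -
    have "v - w \<in> difference_body (superlevel f r)"
      using Cs v(1) w(1) r(1) by (auto simp: difference_body_def)
    then have "v - w \<in> difference_level \<alpha> f r" using r(2) by simp
    then obtain a b where ab: "v - w = a - b" "r \<le> alpha_term \<alpha> (f a) (f b)"
      unfolding difference_level_def by blast
    then have "a \<in> convex hull C" "b \<in> convex hull C"
      using alpha_term_ge_imp_superlevel[OF f \<alpha> ab(2)] r(1) C(2) by auto
    then have "a = v \<and> b = w"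
      using ab(1) w(2) by (intro vertex_difference_unique[OF C(1) v(1) w(1)]) auto
    then show ?thesis using ab(2) by simp
  qed
  have "f v \<le> alpha_term \<alpha> (f v) (f w)"
  proof (rule ccontr)
    assume "\<not> ?thesis"
    then have lt: "alpha_term \<alpha> (f v) (f w) < f v" by simp
    show False
    proof (cases "s = f v")
      case True
      then show False using term_ge[OF refl lev] lt by simp
    next
      case False
      then have "{max s (alpha_term \<alpha> (f v) (f w))<..<f v} \<noteq> {}" using sm lt by auto
      then obtain r where r: "r \<in> {max s (alpha_term \<alpha> (f v) (f w))<..<f v}"
        "0 < r \<and> r \<le> 1 \<and> interior (superlevel f r) \<noteq> {} \<longrightarrow>
          difference_level \<alpha> f r = difference_body (superlevel f r) \<and> P r"
        using AE_lborel_meets_open[OF AE open_greaterThanLessThan] by blast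
      have "superlevel f (f v) \<subseteq> superlevel f r" "superlevel f r \<subseteq> superlevel f s"
        using r(1) by (auto simp: superlevel_def)
      then have rs: "superlevel f r = superlevel f s" using same by blast
      then have "difference_level \<alpha> f r = difference_body (superlevel f r)"
        using r s v(3) by auto
      then have "r \<le> alpha_term \<alpha> (f v) (f w)" by (rule term_ge[OF rs])
      then show False using r(1) by auto
    qed
  qed
  moreover have "0 < f v" "f v \<le> f w" "f w \<le> 1" using sm s v(2)[OF w(1)] C_alphaD(2)[OF f] by auto
  ultimately show "f w = 1"
    using alpha_term_less_left[OF \<alpha>, of "f v" "f w"] v(3) by force
qed

text \<open>
  Otherwise some simplex \<open>L\<^sub>s\<close> has a vertex \<open>v\<close> with \<open>m = f v < 1\<close>, and \<open>f\<close> is 1 at the other vertices.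
  For \<open>r\<close> slightly above \<open>m\<close>, the level \<open>L\<^sub>r\<close> is a simplex that contains these other vertices and
  the midpoints of the edges at \<open>v\<close>, but not \<open>v\<close>. The other vertices are extreme in \<open>L\<^sub>r\<close>, which
  leaves room for just one new vertex \<open>z\<close>. An edge \<open>[v, w]\<close> is a face whose midpoint lies in \<open>L\<^sub>r\<close>,
  which puts \<open>z\<close> on the edge. As \<open>n \<ge> 2\<close>, there are two such edges, and they meet only in \<open>v\<close>.
\<close>
lemma equality_imp_constant_on_support:
  fixes f :: "real ^ 'n \<Rightarrow> real"
  assumes f: "f \<in> C_alpha \<alpha>" and \<alpha>: "\<alpha> \<le> 0" and full: "interior (support f) \<noteq> {}"
    and AE: "AE s in lborel. 0 < s \<and> s \<le> 1 \<and> interior (superlevel f s) \<noteq> {} \<longrightarrow>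
      difference_level \<alpha> f s = difference_body (superlevel f s) \<and> int CARD('n) simplex superlevel f s"
    and n: "CARD('n) \<ge> 2" and x: "0 < f x"
  shows "f x = 1"
proof (rule ccontr)
  assume "f x \<noteq> 1"
  then have x1: "f x < 1" using C_alphaD(2)[OF f, of x] by simp
  obtain s0 where s0: "0 < s0" "\<And>s. s \<le> s0 \<Longrightarrow> interior (superlevel f s) \<noteq> {}"
    by (rule superlevel_interior_nonempty[OF f \<alpha> full]) blast
  have "{0<..<min s0 (f x)} \<noteq> {}" using s0 x by auto
  then obtain s where s: "s \<in> {0<..<min s0 (f x)}"
    "0 < s \<and> s \<le> 1 \<and> interior (superlevel f s) \<noteq> {} \<longrightarrow>
      difference_level \<alpha> f s = difference_body (superlevel f s) \<and> int CARD('n) simplex superlevel f s"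
    using AE_lborel_meets_open[OF AE open_greaterThanLessThan] by blast
  have sint: "interior (superlevel f s) \<noteq> {}" and spos: "0 < s" using s(1) s0 by auto
  then have good: "difference_level \<alpha> f s = difference_body (superlevel f s)"
    "int CARD('n) simplex superlevel f s" using s x1 by auto
  obtain C where C: "\<not> affine_dependent C" "int (card C) = int CARD('n) + 1" "superlevel f s = convex hull C"
    using good(2) by (auto simp: simplex_def)
  have fin: "finite C" by (rule aff_independent_finite[OF C(1)])
  have "C \<noteq> {}" using C(2) by auto
  then have "Min (f ` C) \<in> f ` C" using fin by (intro Min_in) auto
  then obtain v where vmin: "v \<in> C" "f v = Min (f ` C)" by auto
  have v: "v \<in> C" "\<And>u. u \<in> C \<Longrightarrow> f v \<le> f u" using vmin fin by auto
  have "superlevel f s \<subseteq> superlevel f (f v)"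
    unfolding C(3) using v(2)
    by (intro hull_minimal convex_superlevel[OF f \<alpha>]) (auto simp: superlevel_def)
  moreover have "x \<in> superlevel f s" using s(1) by (simp add: superlevel_def)
  ultimately have "f v \<le> f x" unfolding superlevel_def by blast
  then have fv1: "f v < 1" using x1 by simp
  note vv = equality_vertex_values[OF f \<alpha> AE spos sint good(1) C(1,3) v fv1]
  define m where "m = f v"
  have K: "superlevel f m = convex hull C"
  proof -
    have "card C \<ge> 2" using C(2) n by linarith
    then have "C \<noteq> {v}" by auto
    then obtain w where "w \<in> C" "w \<noteq> v" using v(1) by blast
    then show ?thesis using vv(2) C(3) by (simp add: m_def)
  qed
  have Cs: "C \<subseteq> superlevel f s" using C(3) hull_subset by metis
  have m: "0 < m" "m < 1" using fv1 v(1) spos Cs by (auto simp: m_def superlevel_def)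
  have "card (C - {v}) \<ge> 2" using C(2) n v(1) fin by simp
  then obtain W where W: "W \<subseteq> C - {v}" "card W = 2" by (rule obtain_subset_with_card_n)
  then obtain w1 w2 where "W = {w1, w2}" "w1 \<noteq> w2" unfolding card_2_iff by blast
  then have w: "w1 \<in> C - {v}" "w2 \<in> C - {v}" "w1 \<noteq> w2" using W(1) by auto
  let ?q = "alpha_mean \<alpha> (1/2) m 1"
  \<comment> \<open>The bound does not depend on k, so levels just above m contain half-size copies of the simplex.\<close>
  have half: "?q \<le> f ((1/2) *\<^sub>R k + (1/2) *\<^sub>R w)" if k: "k \<in> convex hull C" and w: "w \<in> C - {v}" for k w
  proof -
    have fk: "m \<le> f k" using k K by (auto simp: superlevel_def)
    have fw: "f w = 1" using vv(1)[of w] w by blast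
    have "?q \<le> alpha_mean \<alpha> (1/2) (f k) 1" by (rule alpha_mean_half_gt(2)[OF \<alpha> m fk])
    also have "\<dots> \<le> f ((1/2) *\<^sub>R k + (1 - 1/2) *\<^sub>R w)"
    proof -
      have "(1/2 :: real) \<in> {0..1}" "f k > 0" "f w > 0" using fk m fw by auto
      then show ?thesis using C_alphaD(5)[OF f] fw unfolding alpha_concave_def by metis
    qed
    finally show ?thesis by simp
  qed
  have mq: "m < ?q" by (rule alpha_mean_half_gt(1)[OF \<alpha> m order_refl])
  have vK: "v \<in> convex hull C" by (rule hull_inc[OF v(1)])
  have "?q \<le> 1" using half[OF vK w(1)] C_alphaD(2)[OF f] order_trans by blast
  have "{m<..<?q} \<noteq> {}" using mq by auto
  then obtain r where r: "r \<in> {m<..<?q}"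
    "0 < r \<and> r \<le> 1 \<and> interior (superlevel f r) \<noteq> {} \<longrightarrow>
      difference_level \<alpha> f r = difference_body (superlevel f r) \<and> int CARD('n) simplex superlevel f r"
    using AE_lborel_meets_open[OF AE open_greaterThanLessThan] by blast
  have sub: "(1/2) *\<^sub>R k + (1/2) *\<^sub>R w \<in> superlevel f r" if "k \<in> convex hull C" "w \<in> C - {v}" for k w
    using half[OF that] r(1) by (auto simp: superlevel_def)
  have "interior (superlevel f r) \<noteq> {}"
  proof -
    have "open ((\<lambda>k. (1/2) *\<^sub>R w1 + (1/2) *\<^sub>R k) ` interior (convex hull C))"
      by (rule open_affinity) auto
    moreover have "(\<lambda>k. (1/2) *\<^sub>R w1 + (1/2) *\<^sub>R k) ` interior (convex hull C) \<subseteq> superlevel f r"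
      using sub[OF _ w(1)] interior_subset by (auto simp: add.commute)
    ultimately have "(\<lambda>k. (1/2) *\<^sub>R w1 + (1/2) *\<^sub>R k) ` interior (convex hull C) \<subseteq> interior (superlevel f r)"
      by (rule interior_maximal[rotated])
    then show ?thesis using sint C(3) by auto
  qed
  then have "int CARD('n) simplex superlevel f r" using r m \<open>?q \<le> 1\<close> by auto
  then obtain C' where C': "\<not> affine_dependent C'" "int (card C') = int CARD('n) + 1" "superlevel f r = convex hull C'"
    by (auto simp: simplex_def)
  have K'K: "superlevel f r \<subseteq> convex hull C" unfolding K[symmetric] using r(1) by (auto simp: superlevel_def)
  have vK': "v \<notin> superlevel f r" using r(1) by (auto simp: superlevel_def m_def)
  have "C - {v} \<subseteq> C'"
  proof
    fix u assume u: "u \<in> C - {v}"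
    then have "u extreme_point_of convex hull C"
      using extreme_point_of_convex_hull_affine_independent[OF C(1)] by blast
    moreover have "u \<in> superlevel f r"
    proof -
      have "f u = 1" using vv(1)[of u] u by blast
      then show ?thesis using r(1) \<open>?q \<le> 1\<close> by (auto simp: superlevel_def)
    qed
    ultimately have "u extreme_point_of convex hull C'"
      using K'K unfolding C'(3) by (auto simp: extreme_point_of_def)
    then show "u \<in> C'" by (rule extreme_point_of_convex_hull)
  qed
  moreover have "card C' = Suc (card (C - {v}))" using C'(2) C(2) v(1) fin by simp
  moreover have "finite C'" by (rule aff_independent_finite[OF C'(1)])
  ultimately have "card (C' - (C - {v})) = 1" using fin by (simp add: card_Diff_subset)
  then obtain z where z: "C' - (C - {v}) = {z}" by (rule card_1_singletonE)
  then have C'z: "C' = insert z (C - {v})" using \<open>C - {v} \<subseteq> C'\<close> by blast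
  have zK: "z \<in> convex hull C"
    using K'K hull_subset[of C' convex] unfolding C'(3) C'z by blast
  have edge: "z \<in> convex hull {v, w}" if w: "w \<in> C - {v}" for w
  proof -
    let ?p = "(1/2) *\<^sub>R v + (1/2) *\<^sub>R w"
    have face: "convex hull {v, w} face_of convex hull C"
      unfolding face_of_convex_hull_affine_independent[OF C(1)]
      using v(1) w by (intro exI[of _ "{v, w}"]) auto
    have pe: "?p \<in> convex hull {v, w}" 
      unfolding convex_hull_2 by (rule CollectI, rule exI[of _ "1/2"], rule exI[of _ "1/2"]) simp
    have po: "?p \<in> open_segment v w" using w by (auto simp: in_segment intro!: exI[of _ "1/2"])
    have ne: "C - {v} \<noteq> {}" using w by blast
    have "?p \<in> convex hull (insert z (C - {v}))" using sub[OF vK w] C'(3) C'z by simp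
    then obtain a b q where ab: "0 \<le> a" "0 \<le> b" "a + b = 1" "q \<in> convex hull (C - {v})" "?p = a *\<^sub>R z + b *\<^sub>R q"
      unfolding convex_hull_insert[OF ne] by blast
    have qK: "q \<in> convex hull C" using ab(4) hull_mono[of "C - {v}" C convex] by blast
    have "a \<noteq> 0"
    proof
      assume "a = 0"
      then have "?p \<in> convex hull (C - {v})" using ab by simp
      moreover have "convex hull (C - {v}) face_of convex hull C"
        unfolding face_of_convex_hull_affine_independent[OF C(1)]
        by (intro exI[of _ "C - {v}"]) auto
      ultimately have "v \<in> convex hull (C - {v})"
        using face_ofD[OF _ po vK] w hull_inc[of w C convex] by blast
      then have "v \<in> affine hull (C - {v})" using convex_hull_subset_affine_hull by blast
      then show False using C(1) v(1) unfolding affine_dependent_def by blast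
    qed
    show ?thesis
    proof (cases "z = q \<or> b = 0")
      case True
      then have "?p = z"
      proof
        assume "z = q"
        then have "?p = (a + b) *\<^sub>R z" using ab(5) by (simp add: scaleR_add_left)
        then show ?thesis using ab(3) by simp
      qed (use ab in simp)
      then show ?thesis using pe by simp
    next
      case False
      then have "?p \<in> open_segment z q"
        unfolding in_segment using ab \<open>a \<noteq> 0\<close>
        by (intro conjI exI[of _ b]) (auto simp: eq_diff_eq[symmetric])
      then show ?thesis using face_ofD[OF face _ zK qK pe] by blast
    qed
  qed
  have "\<not> affine_dependent ({v, w1} \<union> {v, w2})"
    using C(1) v(1) w affine_dependent_subset[of "{v, w1} \<union> {v, w2}" C] by blast
  then have "convex hull {v, w1} \<inter> convex hull {v, w2} = convex hull ({v, w1} \<inter> {v, w2})"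
    by (rule convex_hull_Int[symmetric])
  also have "{v, w1} \<inter> {v, w2} = {v}" using w by auto
  finally have "convex hull {v, w1} \<inter> convex hull {v, w2} = {v}" by simp
  then have "z = v" using edge[OF w(1)] edge[OF w(2)] by blast
  moreover have "z \<in> superlevel f r" unfolding C'(3) C'z by (simp add: hull_inc)
  ultimately show False using vK' by simp
qed

lemma equality_imp_indicator_simplex:
  fixes f :: "real ^ 'n \<Rightarrow> real"
  assumes f: "f \<in> C_alpha \<alpha>" and \<alpha>: "\<alpha> \<le> 0" and full: "interior (support f) \<noteq> {}"
    and AE: "AE s in lborel. 0 < s \<and> s \<le> 1 \<and> interior (superlevel f s) \<noteq> {} \<longrightarrow>
      difference_level \<alpha> f s = difference_body (superlevel f s) \<and> int CARD('n) simplex superlevel f s"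
    and n: "CARD('n) \<ge> 2"
  shows "\<exists>S. int CARD('n) simplex S \<and> f = indicator S"
proof -
  obtain s0 where s0: "0 < s0" "\<And>s. s \<le> s0 \<Longrightarrow> interior (superlevel f s) \<noteq> {}"
    by (rule superlevel_interior_nonempty[OF f \<alpha> full]) blast
  have "{0<..<min s0 1} \<noteq> {}" using s0 by auto
  then obtain s where s: "s \<in> {0<..<min s0 1}"
    "0 < s \<and> s \<le> 1 \<and> interior (superlevel f s) \<noteq> {} \<longrightarrow>
      difference_level \<alpha> f s = difference_body (superlevel f s) \<and> int CARD('n) simplex superlevel f s"
    using AE_lborel_meets_open[OF AE open_greaterThanLessThan] by blast
  then have "int CARD('n) simplex superlevel f s" using s0(2)[of s] by auto
  moreover have "f x = indicator (superlevel f s) x" for x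
  proof (cases "0 < f x")
    case True
    then have "f x = 1" by (rule equality_imp_constant_on_support[OF f \<alpha> full AE n])
    then show ?thesis using s(1) by (simp add: superlevel_def indicator_def)
  next
    case False
    then have "f x = 0" using C_alphaD(1)[OF f, of x] by simp
    then show ?thesis using s(1) by (simp add: superlevel_def indicator_def)
  qed
  ultimately show ?thesis by blast
qed

lemma equality_of_indicator_simplex:
  fixes S :: "(real ^ 'n) set"
  assumes f: "indicator S \<in> C_alpha \<alpha>" and \<alpha>: "\<alpha> \<le> 0" and S: "int CARD('n) simplex S"
  shows "L1_norm (alpha_sum \<alpha> (indicator S) (reflect (indicator S)))
     = of_nat ((2 * CARD('n)) choose CARD('n)) * L1_norm (indicator S :: real ^ 'n \<Rightarrow> real)"
proof (rule equality_of_all_levels[OF f \<alpha>])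
  fix s :: real assume s: "0 < s" "s \<le> 1"
  have L: "superlevel (indicator S) s = S" using s by (auto simp: superlevel_def indicator_def)
  have "difference_body S \<subseteq> difference_level \<alpha> (indicator S) s"
  proof
    fix x assume "x \<in> difference_body S"
    then obtain a b where ab: "a \<in> S" "b \<in> S" "x = a - b" unfolding difference_body_def by blast
    then have "s \<le> alpha_term \<alpha> (indicator S a) (indicator S b)" using s by (simp add: alpha_term_def)
    then show "x \<in> difference_level \<alpha> (indicator S) s" unfolding difference_level_def using ab(3) by blast
  qed
  then have "difference_level \<alpha> (indicator S) s = difference_body S"
    using difference_level_subset[OF f \<alpha>, of s] L by auto
  then show "emeasure lborel (difference_level \<alpha> (indicator S) s)
      = of_nat ((2 * CARD('n)) choose CARD('n)) * emeasure lborel (superlevel (indicator S) s)"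
    using rogers_shephard_equality_of_simplex[of S] S L by simp
qed

section \<open>Equality in dimension one\<close>

text \<open>
  Quasi-concavity in terms of the single coordinate \<open>i\<close>.
\<close>
lemma C_alpha_between_ge_min_dim1:
  fixes f :: "real ^ 'n \<Rightarrow> real"
  assumes f: "f \<in> C_alpha \<alpha>" and \<alpha>: "\<alpha> \<le> 0" and i: "\<And>j. j = (i :: 'n)"
    and xyz: "x $ i \<le> y $ i" "y $ i \<le> z $ i"
  shows "min (f x) (f z) \<le> f y"
proof (cases "x $ i = z $ i")
  case True
  then have "x = y" using xyz i by (simp add: vec_eq_iff) (metis order_antisym)
  then show ?thesis by simp
next
  case False
  then have lt: "x $ i < z $ i" using xyz by simp
  define t where "t = (z $ i - y $ i) / (z $ i - x $ i)"
  have t: "0 \<le> t" "t \<le> 1" using lt xyz by (auto simp: t_def)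
  have td: "t * (z $ i - x $ i) = z $ i - y $ i" using lt by (simp add: t_def)
  have "(t *\<^sub>R x + (1 - t) *\<^sub>R z) $ i = z $ i - t * (z $ i - x $ i)" by (simp add: algebra_simps)
  then have "(t *\<^sub>R x + (1 - t) *\<^sub>R z) $ i = y $ i" using td by simp
  then have "t *\<^sub>R x + (1 - t) *\<^sub>R z = y" using i by (metis vec_eq_iff)
  then show ?thesis using C_alpha_convex_combination_ge_min[OF f \<alpha> t, of x z] by simp
qed

text \<open>
  If \<open>f\<close> were not monotone, it would take values below 1 in the support on both sides of the
  maximum at 0. A level containing such points on both sides is an interval with \<open>f = 1\<close>
  at one end, and then \<open>f = 1\<close> between that end and 0, a contradiction.
\<close>
lemma equality_imp_monotone_dim1:
  fixes f :: "real ^ 'n \<Rightarrow> real"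
  assumes f: "f \<in> C_alpha \<alpha>" and \<alpha>: "\<alpha> \<le> 0" and full: "interior (support f) \<noteq> {}"
    and AE: "AE s in lborel. 0 < s \<and> s \<le> 1 \<and> interior (superlevel f s) \<noteq> {} \<longrightarrow>
      difference_level \<alpha> f s = difference_body (superlevel f s) \<and> int CARD('n) simplex superlevel f s"
    and n: "CARD('n) = 1"
  shows "monotone_on_support f"
proof -
  obtain i :: 'n where "UNIV = {i}" using n card_1_singletonE by blast
  then have i: "j = i" for j by blast
  note between = C_alpha_between_ge_min_dim1[OF f \<alpha> i]
  have le_iff: "x \<le> y \<longleftrightarrow> x $ i \<le> y $ i" for x y :: "real ^ 'n"
    unfolding less_eq_vec_def using i by metis
  have no: False if xy: "x $ i < 0" "0 < y $ i" "0 < f x" "0 < f y" "f x < 1" "f y < 1" for x y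
  proof -
    obtain s0 where s0: "0 < s0" "\<And>s. s \<le> s0 \<Longrightarrow> interior (superlevel f s) \<noteq> {}"
      by (rule superlevel_interior_nonempty[OF f \<alpha> full]) blast
    have "{0<..<min s0 (min (f x) (f y))} \<noteq> {}" using s0 xy by auto
    then obtain s where s: "s \<in> {0<..<min s0 (min (f x) (f y))}"
      "0 < s \<and> s \<le> 1 \<and> interior (superlevel f s) \<noteq> {} \<longrightarrow>
        difference_level \<alpha> f s = difference_body (superlevel f s) \<and> int CARD('n) simplex superlevel f s"
      using AE_lborel_meets_open[OF AE open_greaterThanLessThan] by blast
    have sint: "interior (superlevel f s) \<noteq> {}" and spos: "0 < s" using s(1) s0 by auto
    have good: "difference_level \<alpha> f s = difference_body (superlevel f s)"
      "int CARD('n) simplex superlevel f s" using s sint xy by auto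
    obtain C where C: "\<not> affine_dependent C" "int (card C) = int CARD('n) + 1" "superlevel f s = convex hull C"
      using good(2) by (auto simp: simplex_def)
    have "card C = 2" using C(2) n by simp
    then obtain p q where pq: "C = {p, q}" "p \<noteq> q" unfolding card_2_iff by blast
    have main: False if ab: "C = {a, b}" "a \<noteq> b" "f a \<le> f b" for a b
    proof -
      have xs: "x \<in> superlevel f s" "y \<in> superlevel f s" using s(1) by (simp_all add: superlevel_def)
      then have x: "x \<in> convex hull {a, b}" and y: "y \<in> convex hull {a, b}"
        unfolding C(3) ab(1) .
      have "superlevel f s \<subseteq> superlevel f (f a)"
        unfolding C(3) ab(1) using ab(3)
        by (intro hull_minimal convex_superlevel[OF f \<alpha>]) (auto simp: superlevel_def)
      then have "f a \<le> f x" using xs(1) unfolding superlevel_def by blast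
      then have fa: "f a < 1" using xy by simp
      have fb: "f b = 1"
        by (rule equality_vertex_values(1)[OF f \<alpha> AE spos sint good(1) C(1,3), of a]) (use ab fa in auto)
      obtain u u' where u: "0 \<le> u" "0 \<le> u'" "u + u' = 1" "x = u *\<^sub>R a + u' *\<^sub>R b"
        using x unfolding convex_hull_2 by blast
      obtain v v' where v: "0 \<le> v" "0 \<le> v'" "v + v' = 1" "y = v *\<^sub>R a + v' *\<^sub>R b"
        using y unfolding convex_hull_2 by blast
      have xi: "x $ i = u * a $ i + u' * b $ i" and yi: "y $ i = v * a $ i + v' * b $ i"
        using u v by simp_all
      \<comment> \<open>If b lies outside the open interval from x to y, then x or y lies between b and 0.\<close>
      consider "b $ i \<le> x $ i" | "y $ i \<le> b $ i" | "x $ i < b $ i" "b $ i < y $ i" by linarith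
      then show False
      proof cases
        case 1
        have "min (f b) (f 0) \<le> f x" by (rule between) (use 1 xy in auto)
        then show False using fb C_alphaD(3)[OF f] xy by simp
      next
        case 2
        have "min (f 0) (f b) \<le> f y" by (rule between) (use 2 xy in auto)
        then show False using fb C_alphaD(3)[OF f] xy by simp
      next
        case 3
        show False
        proof (cases "a $ i \<le> b $ i")
          case True
          then have "v * a $ i + v' * b $ i \<le> v * b $ i + v' * b $ i" using v by (intro add_right_mono mult_left_mono) auto
          also have "\<dots> = b $ i" using v(3) by (simp add: distrib_right[symmetric])
          finally show False using 3 yi by simp
        next
          case False
          then have "u * b $ i + u' * b $ i \<le> u * a $ i + u' * b $ i" using u by (intro add_right_mono mult_left_mono) auto
          moreover have "u * b $ i + u' * b $ i = b $ i" using u(3) by (simp add: distrib_right[symmetric])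
          ultimately show False using 3 xi by simp
        qed
      qed
    qed
    show False
    proof (cases "f p \<le> f q")
      case True
      then show False using main[of p q] pq by simp
    next
      case False
      moreover have "C = {q, p}" using pq(1) by auto
      ultimately show False using main[of q p] pq(2) by auto
    qed
  qed
  show ?thesis
  proof (cases "\<forall>x. 0 < f x \<longrightarrow> x $ i < 0 \<longrightarrow> f x = 1")
    case True
    have "f q \<le> f p" if pq: "p \<in> support f" "q \<in> support f" "p \<le> q" for p q
    proof (cases "0 < p $ i")
      case True
      have "min (f 0) (f q) \<le> f p" by (rule between) (use True pq le_iff in auto)
      then show ?thesis using C_alphaD(2,3)[OF f] by simp
    next
      case False
      have "f p = 1"
      proof (cases "p $ i = 0")
        case True
        then have "p = 0" using i by (metis vec_eq_iff zero_index)
        then show ?thesis using C_alphaD(3)[OF f] by simp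
      next
        case False
        then show ?thesis using \<open>\<forall>x. _\<close> \<open>\<not> 0 < p $ i\<close> pq(1) by (simp add: support_def)
      qed
      then show ?thesis using C_alphaD(2)[OF f] by simp
    qed
    then have "antimono_on (support f) f" by (intro monotone_onI)
    then show ?thesis by (simp add: monotone_on_support_def)
  next
    case False
    then obtain x where x: "0 < f x" "x $ i < 0" "f x < 1" using C_alphaD(2)[OF f] by (meson less_eq_real_def)
    have right: "f y = 1" if "0 < f y" "0 < y $ i" for y
      using no[OF x(2) that(2) x(1) that(1) x(3)] C_alphaD(2)[OF f, of y] by fastforce
    have "f p \<le> f q" if pq: "p \<in> support f" "q \<in> support f" "p \<le> q" for p q
    proof (cases "q $ i < 0")
      case True
      have "min (f p) (f 0) \<le> f q" by (rule between) (use True pq le_iff in auto)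
      then show ?thesis using C_alphaD(2,3)[OF f] by simp
    next
      case False
      have "f q = 1"
      proof (cases "q $ i = 0")
        case True
        then have "q = 0" using i by (metis vec_eq_iff zero_index)
        then show ?thesis using C_alphaD(3)[OF f] by simp
      next
        case False
        then show ?thesis using right[of q] \<open>\<not> q $ i < 0\<close> pq(2) by (simp add: support_def)
      qed
      then show ?thesis using C_alphaD(2)[OF f] by simp
    qed
    then have "mono_on (support f) f" by (intro monotone_onI)
    then show ?thesis by (simp add: monotone_on_support_def)
  qed
qed

lemma simplex_of_compact_convex_dim1:
  fixes K :: "(real ^ 'n) set"
  assumes n: "CARD('n) = 1" and K: "convex K" "compact K" "interior K \<noteq> {}"
  shows "int CARD('n) simplex K"
proof -
  obtain i :: 'n where "UNIV = {i}" using n card_1_singletonE by blast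
  then have i: "j = i" for j by blast
  have ne: "K \<noteq> {}" using K(3) by auto
  have cont: "continuous_on K (\<lambda>x. x $ i)" by (intro continuous_intros)
  obtain a where a: "a \<in> K" "\<And>x. x \<in> K \<Longrightarrow> a $ i \<le> x $ i"
    using continuous_attains_inf[OF K(2) ne cont] by blast
  obtain b where b: "b \<in> K" "\<And>x. x \<in> K \<Longrightarrow> x $ i \<le> b $ i"
    using continuous_attains_sup[OF K(2) ne cont] by blast
  have ext: "x = y" if "x $ i = y $ i" for x y :: "real ^ 'n" using that i by (metis vec_eq_iff)
  have "a \<noteq> b"
  proof
    assume "a = b"
    then have "x = a" if "x \<in> K" for x using a(2)[OF that] b(2)[OF that] by (intro ext) simp
    then have "K \<subseteq> {a}" by blast
    then have "interior K \<subseteq> interior {a}" by (rule interior_mono)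
    then show False using K(3) by simp
  qed
  then have lt: "a $ i < b $ i" using a(2)[OF b(1)] ext by (metis less_eq_real_def)
  have "K = convex hull {a, b}"
  proof
    show "convex hull {a, b} \<subseteq> K" using a b K(1) by (intro hull_minimal) auto
    show "K \<subseteq> convex hull {a, b}"
    proof
      fix x assume x: "x \<in> K"
      define t where "t = (x $ i - a $ i) / (b $ i - a $ i)"
      have t: "0 \<le> t" "t \<le> 1" using lt a(2)[OF x] b(2)[OF x] by (auto simp: t_def)
      have "t * (b $ i - a $ i) = x $ i - a $ i" using lt by (simp add: t_def)
      then have "x $ i = ((1 - t) *\<^sub>R a + t *\<^sub>R b) $ i" by (simp add: algebra_simps)
      then have "x = (1 - t) *\<^sub>R a + t *\<^sub>R b" by (rule ext)
      moreover have "0 \<le> 1 - t" "1 - t + t = 1" using t by auto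
      ultimately show "x \<in> convex hull {a, b}" unfolding convex_hull_2 using t(1) by blast
    qed
  qed
  moreover have "int (card {a, b}) = int CARD('n) + 1" using \<open>a \<noteq> b\<close> n by simp
  ultimately show ?thesis unfolding simplex_def using affine_independent_2 by blast
qed

text \<open>
  With \<open>f e = 1\<close> the \<open>\<alpha>\<close>-term of \<open>f u\<close> and \<open>f e\<close> is \<open>f u\<close>, so every difference with \<open>e\<close> inside the
  level is attained.
\<close>
lemma difference_body_subset_difference_level:
  fixes f :: "real ^ 'n \<Rightarrow> real"
  assumes f: "f \<in> C_alpha \<alpha>" and \<alpha>: "\<alpha> \<le> 0" and e: "f e = 1"
    and sh: "\<And>y z. y \<in> superlevel f s \<Longrightarrow> z \<in> superlevel f s \<Longrightarrow>
      e + (y - z) \<in> superlevel f s \<or> e - (y - z) \<in> superlevel f s"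
  shows "difference_body (superlevel f s) \<subseteq> difference_level \<alpha> f s"
proof
  fix x assume "x \<in> difference_body (superlevel f s)"
  then obtain y z where yz: "y \<in> superlevel f s" "z \<in> superlevel f s" "x = y - z"
    unfolding difference_body_def by blast
  have t: "alpha_term \<alpha> (f u) (f e) = f u" "alpha_term \<alpha> (f e) (f u) = f u" for u
    using alpha_term_one[OF \<alpha> C_alphaD(1)[OF f], of u] e alpha_term_commute by simp_all
  from sh[OF yz(1,2)] show "x \<in> difference_level \<alpha> f s"
  proof
    assume "e + (y - z) \<in> superlevel f s"
    then have "s \<le> alpha_term \<alpha> (f (e + x)) (f e)" by (simp add: t superlevel_def yz(3))
    moreover have "x = (e + x) - e" by simp
    ultimately show ?thesis unfolding difference_level_def by blast
  next
    assume "e - (y - z) \<in> superlevel f s"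
    then have "s \<le> alpha_term \<alpha> (f e) (f (e - x))" by (simp add: t superlevel_def yz(3))
    moreover have "x = e - (e - x)" by simp
    ultimately show ?thesis unfolding difference_level_def by blast
  qed
qed

text \<open>
  Monotonicity gives the value 1 at one end \<open>e\<close> of each level interval, and every
  difference of points of the interval is, up to sign, a difference with \<open>e\<close>.
\<close>
lemma equality_of_monotone_dim1:
  fixes f :: "real ^ 'n \<Rightarrow> real"
  assumes f: "f \<in> C_alpha \<alpha>" and \<alpha>: "\<alpha> \<le> 0" and n: "CARD('n) = 1" and mono: "monotone_on_support f"
  shows "L1_norm (alpha_sum \<alpha> f (reflect f)) = of_nat ((2 * CARD('n)) choose CARD('n)) * L1_norm f"
proof (rule equality_of_all_levels[OF f \<alpha>])
  fix s :: real assume s: "0 < s" "s \<le> 1"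
  obtain i :: 'n where "UNIV = {i}" using n card_1_singletonE by blast
  then have i: "j = i" for j by blast
  have le_iff: "x \<le> y \<longleftrightarrow> x $ i \<le> y $ i" for x y :: "real ^ 'n"
    unfolding less_eq_vec_def using i by metis
  let ?K = "superlevel f s"
  have K: "convex ?K" "compact ?K" using convex_superlevel[OF f \<alpha>] compact_superlevel[OF f s(1)] by auto
  have K0: "0 \<in> ?K" using s C_alphaD(3)[OF f] by (simp add: superlevel_def)
  have Ksup: "?K \<subseteq> support f" using s by (auto simp: superlevel_def support_def)
  have between: "y \<in> ?K" if "x \<in> ?K" "z \<in> ?K" "x $ i \<le> y $ i" "y $ i \<le> z $ i" for x y z
    using C_alpha_between_ge_min_dim1[OF f \<alpha> i that(3,4)] that(1,2)
    by (simp add: superlevel_def min_def split: if_splits)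
  have ne: "?K \<noteq> {}" using K0 by blast
  have cont: "continuous_on ?K (\<lambda>x. x $ i)" by (intro continuous_intros)
  obtain a where a: "a \<in> ?K" "\<And>x. x \<in> ?K \<Longrightarrow> a $ i \<le> x $ i"
    using continuous_attains_inf[OF K(2) ne cont] by blast
  obtain b where b: "b \<in> ?K" "\<And>x. x \<in> ?K \<Longrightarrow> x $ i \<le> b $ i"
    using continuous_attains_sup[OF K(2) ne cont] by blast
  have sup0: "0 \<in> support f" "a \<in> support f" "b \<in> support f" using K0 a(1) b(1) Ksup by auto
  have "difference_body ?K \<subseteq> difference_level \<alpha> f s"
    using mono unfolding monotone_on_support_def
  proof
    assume "mono_on (support f) f"
    then have "f 0 \<le> f b" using monotone_onD[OF _ sup0(1,3)] b(2)[OF K0] le_iff by blast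
    then have fb: "f b = 1" using C_alphaD(2)[OF f, of b] C_alphaD(3)[OF f] by simp
    show ?thesis
    proof (rule difference_body_subset_difference_level[OF f \<alpha> fb])
      fix y z assume y: "y \<in> ?K" and z: "z \<in> ?K"
      show "b + (y - z) \<in> ?K \<or> b - (y - z) \<in> ?K"
      proof (cases "y $ i \<le> z $ i")
        case True
        have "b + (y - z) \<in> ?K" by (rule between[OF y b(1)]) (use True b(2)[OF z] in auto)
        then show ?thesis ..
      next
        case False
        have "b - (y - z) \<in> ?K" by (rule between[OF z b(1)]) (use False b(2)[OF y] in auto)
        then show ?thesis ..
      qed
    qed
  next
    assume "antimono_on (support f) f"
    then have "f 0 \<le> f a" using monotone_onD[OF _ sup0(2,1)] a(2)[OF K0] le_iff by blast
    then have fa: "f a = 1" using C_alphaD(2)[OF f, of a] C_alphaD(3)[OF f] by simp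
    show ?thesis
    proof (rule difference_body_subset_difference_level[OF f \<alpha> fa])
      fix y z assume y: "y \<in> ?K" and z: "z \<in> ?K"
      show "a + (y - z) \<in> ?K \<or> a - (y - z) \<in> ?K"
      proof (cases "y $ i \<le> z $ i")
        case True
        have "a - (y - z) \<in> ?K" by (rule between[OF a(1) z]) (use True a(2)[OF y] in auto)
        then show ?thesis ..
      next
        case False
        have "a + (y - z) \<in> ?K" by (rule between[OF a(1) y]) (use False a(2)[OF z] in auto)
        then show ?thesis ..
      qed
    qed
  qed
  then have lev: "difference_level \<alpha> f s = difference_body ?K"
    using difference_level_subset[OF f \<alpha>, of s] by auto
  show "emeasure lborel (difference_level \<alpha> f s)
      = of_nat ((2 * CARD('n)) choose CARD('n)) * emeasure lborel ?K"
  proof (cases "interior ?K = {}")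
    case True
    then have "emeasure lborel ?K = 0"
      using negligible_convex_interior[OF K(1)] K(2) by (simp add: negligible_iff_emeasure0 borel_compact)
    then show ?thesis
      using emeasure_difference_body_empty_interior[OF K True] lev by simp
  next
    case False
    have "int DIM(real ^ 'n) simplex ?K" using simplex_of_compact_convex_dim1[OF n K False] by simp
    then show ?thesis using rogers_shephard_equality_of_simplex[of ?K] lev by simp
  qed
qed

theorem theorem1p4:
  fixes f :: "real ^ 'n \<Rightarrow> real" and \<alpha> :: real
  assumes "\<alpha> \<le> 0"
    and "f \<in> C_alpha \<alpha>"
    and "integrable lborel f"
    and "interior (support f) \<noteq> {}"
  shows "L1_norm (alpha_sum \<alpha> f (reflect f))
           \<le> of_nat ((2 * CARD('n)) choose CARD('n)) * L1_norm f
    \<and> (CARD('n) \<ge> 2 \<longrightarrow>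
         (L1_norm (alpha_sum \<alpha> f (reflect f))
            = of_nat ((2 * CARD('n)) choose CARD('n)) * L1_norm f
          \<longleftrightarrow> (\<exists>S. int CARD('n) simplex S \<and> f = indicator S)))
    \<and> (CARD('n) = 1 \<longrightarrow>
         (L1_norm (alpha_sum \<alpha> f (reflect f))
            = of_nat ((2 * CARD('n)) choose CARD('n)) * L1_norm f
          \<longleftrightarrow> monotone_on_support f))"
proof (intro conjI impI)
  show "L1_norm (alpha_sum \<alpha> f (reflect f)) \<le> of_nat ((2 * CARD('n)) choose CARD('n)) * L1_norm f"
    by (rule L1_norm_alpha_sum_reflect_le[OF assms(2,1)])
next
  assume n: "CARD('n) \<ge> 2"
  show "L1_norm (alpha_sum \<alpha> f (reflect f)) = of_nat ((2 * CARD('n)) choose CARD('n)) * L1_norm f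
      \<longleftrightarrow> (\<exists>S. int CARD('n) simplex S \<and> f = indicator S)"
    using equality_imp_indicator_simplex[OF assms(2,1,4) equality_imp_AE_level[OF assms(2,1,3)] n]
      equality_of_indicator_simplex assms(1,2) by blast
next
  assume n: "CARD('n) = 1"
  show "L1_norm (alpha_sum \<alpha> f (reflect f)) = of_nat ((2 * CARD('n)) choose CARD('n)) * L1_norm f
      \<longleftrightarrow> monotone_on_support f"
    using equality_imp_monotone_dim1[OF assms(2,1,4) equality_imp_AE_level[OF assms(2,1,3)] n]
      equality_of_monotone_dim1[OF assms(2,1) n] by blast
qed

end
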